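(* Let $H$ denote either the algebra $A_u$ or the algebra $H^\infty$. If $\ell_1$ satisfies the cluster value theorem for $H$, then so does $L_1=L_1(0,1)$.
   Context: All Banach spaces are complex. For a Banach space $X$, $B_X$ denotes its open unit ball. $H^\infty(B_X)$ is the Banach algebra (sup norm over $B_X$, pointwise operations) of all bounded analytic functions $f:B_X\to\mathbb{C}$, and $A_u(B_X)$ is the subalgebra of those $f\in H^\infty(B_X)$ that are uniformly continuous on $B_X$. Elements of $X^*$ are regarded as elements of these algebras by restriction to $B_X$. Let $H(B_X)$ be one of the two algebras and let $x^{**}$ be in the closed unit ball of $X^{**}$. For $f\in H(B_X)$, the cluster set $Cl_{B_X}(f,x^{**})\subset\mathbb{C}$ is the set of all limits of $f(x_\alpha)$ along nets $(x_\alpha)$ in $B_X$ that converge to $x^{**}$ in the weak$^*$ topology of $X^{**}$. $M_{x^{**}}(B_X)$ is the set of (nonzero) multiplicative linear functionals $\tau$ on $H(B_X)$ such that $\tau(x^* )=\langle x^{**},x^*\rangle$ for all $x^*\in X^*$. $H(B_X)$ satisfies the cluster value theorem at $x^{**}$ if for every $f\in H(B_X)$ one has $\{\tau(f):\tau\in M_{x^{**}}(B_X)\}\subset Cl_{B_X}(f,x^{**})$. The space $X$ satisfies the cluster value theorem for $H$ if $H(B_X)$ satisfies the cluster value theorem at every $x^{**}$ in the closed unit ball of $X^{**}$. *)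

theory Defs
  imports "HOL-Analysis.Analysis"
begin

section \<open>Complex normed spaces\<close>

class complex_normed_vector = real_normed_vector +
  fixes scaleC :: "complex \<Rightarrow> 'a \<Rightarrow> 'a" (infixr \<open>*\<^sub>C\<close> 75)
  assumes scaleC_add_right: "c *\<^sub>C (x + y) = c *\<^sub>C x + c *\<^sub>C y"
    and scaleC_add_left: "(c + d) *\<^sub>C x = c *\<^sub>C x + d *\<^sub>C x"
    and scaleC_scaleC: "c *\<^sub>C d *\<^sub>C x = (c * d) *\<^sub>C x"
    and scaleC_of_real: "complex_of_real r *\<^sub>C x = r *\<^sub>R x"
    and norm_scaleC: "norm (c *\<^sub>C x) = cmod c * norm x"


section \<open>The dual space\<close>

typedef (overloaded) 'a cdual =
  "{g :: ('a::complex_normed_vector) \<Rightarrow>\<^sub>L complex.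
      \<forall>c x. blinfun_apply g (c *\<^sub>C x) = c * blinfun_apply g x}"
  by (rule exI[of _ 0]) auto

setup_lifting type_definition_cdual

definition cdual_apply :: "'a::complex_normed_vector cdual \<Rightarrow> 'a \<Rightarrow> complex"
  where "cdual_apply g = blinfun_apply (Rep_cdual g)"

instantiation cdual :: (complex_normed_vector) complex_normed_vector
begin

text \<open>The norm is inherited from the bounded linear maps, i.e. it is the operator norm.\<close>

lift_definition norm_cdual :: "'a cdual \<Rightarrow> real" is norm .

lift_definition zero_cdual :: "'a cdual" is 0
  by auto

lift_definition plus_cdual :: "'a cdual \<Rightarrow> 'a cdual \<Rightarrow> 'a cdual" is "(+)"
  by (auto simp: blinfun.bilinear_simps algebra_simps)

lift_definition minus_cdual :: "'a cdual \<Rightarrow> 'a cdual \<Rightarrow> 'a cdual" is "(-)"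
  by (auto simp: blinfun.bilinear_simps algebra_simps)

lift_definition uminus_cdual :: "'a cdual \<Rightarrow> 'a cdual" is uminus
  by (auto simp: blinfun.bilinear_simps)

lift_definition scaleR_cdual :: "real \<Rightarrow> 'a cdual \<Rightarrow> 'a cdual" is "(*\<^sub>R)"
  by (auto simp: blinfun.bilinear_simps)

lift_definition scaleC_cdual :: "complex \<Rightarrow> 'a cdual \<Rightarrow> 'a cdual"
  is "\<lambda>c g. blinfun_compose (Blinfun ((*) c)) g"
  by (auto simp: bounded_linear_Blinfun_apply bounded_linear_mult_right)

definition dist_cdual :: "'a cdual \<Rightarrow> 'a cdual \<Rightarrow> real"
  where "dist_cdual g h = norm (g - h)"

definition sgn_cdual :: "'a cdual \<Rightarrow> 'a cdual"
  where "sgn_cdual g = inverse (norm g) *\<^sub>R g"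

definition uniformity_cdual :: "('a cdual \<times> 'a cdual) filter"
  where "uniformity_cdual = (INF e\<in>{0 <..}. principal {(x, y). dist x y < e})"

definition open_cdual :: "'a cdual set \<Rightarrow> bool"
  where "open_cdual S = (\<forall>x\<in>S. \<forall>\<^sub>F (x', y) in uniformity. x' = x \<longrightarrow> y \<in> S)"

instance
proof
  fix g h k :: "'a cdual" and r s :: real and c d :: complex
  show "dist g h = norm (g - h)" by (rule dist_cdual_def)
  show "sgn g = inverse (norm g) *\<^sub>R g" by (rule sgn_cdual_def)
  show "(uniformity :: ('a cdual \<times> 'a cdual) filter) = (INF e\<in>{0 <..}. principal {(x, y). dist x y < e})"
    by (rule uniformity_cdual_def)
  show "open S = (\<forall>x\<in>S. \<forall>\<^sub>F (x', y) in uniformity. x' = x \<longrightarrow> y \<in> S)" for S :: "'a cdual set"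
    by (rule open_cdual_def)
  show "g + h + k = g + (h + k)" by transfer (simp add: algebra_simps)
  show "g + h = h + g" by transfer (simp add: algebra_simps)
  show "0 + g = g" by transfer simp
  show "- g + g = 0" by transfer simp
  show "g - h = g + - h" by transfer simp
  show "r *\<^sub>R (g + h) = r *\<^sub>R g + r *\<^sub>R h" by transfer (simp add: algebra_simps)
  show "(r + s) *\<^sub>R g = r *\<^sub>R g + s *\<^sub>R g" by transfer (simp add: algebra_simps)
  show "r *\<^sub>R s *\<^sub>R g = (r * s) *\<^sub>R g" by transfer simp
  show "1 *\<^sub>R g = g" by transfer simp
  show "(norm g = 0) = (g = 0)" by transfer simp
  show "norm (g + h) \<le> norm g + norm h" by transfer (rule norm_triangle_ineq)
  show "norm (r *\<^sub>R g) = \<bar>r\<bar> * norm g" by transfer simp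
  show "c *\<^sub>C (g + h) = c *\<^sub>C g + c *\<^sub>C h"
    by transfer (auto intro!: blinfun_eqI simp: bounded_linear_Blinfun_apply bounded_linear_mult_right
        blinfun.bilinear_simps algebra_simps)
  show "(c + d) *\<^sub>C g = c *\<^sub>C g + d *\<^sub>C g"
    by transfer (auto intro!: blinfun_eqI simp: bounded_linear_Blinfun_apply bounded_linear_mult_right
        blinfun.bilinear_simps algebra_simps)
  show "c *\<^sub>C d *\<^sub>C g = (c * d) *\<^sub>C g"
    by transfer (auto intro!: blinfun_eqI simp: bounded_linear_Blinfun_apply bounded_linear_mult_right
        blinfun.bilinear_simps algebra_simps)
  show "complex_of_real r *\<^sub>C g = r *\<^sub>R g"
    by transfer (auto intro!: blinfun_eqI simp: bounded_linear_Blinfun_apply bounded_linear_mult_right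
        blinfun.bilinear_simps scaleR_conv_of_real)
  show "norm (c *\<^sub>C g) = cmod c * norm g"
  proof transfer
    fix c :: complex and g :: "'a \<Rightarrow>\<^sub>L complex"
    have "norm (blinfun_compose (Blinfun ((*) c)) g) = onorm (\<lambda>x. c * blinfun_apply g x)"
      by (simp add: norm_blinfun.rep_eq blinfun_compose.rep_eq bounded_linear_Blinfun_apply
          bounded_linear_mult_right comp_def)
    also have "\<dots> = onorm (\<lambda>x. cmod c *\<^sub>R blinfun_apply g x)"
      by (simp add: onorm_def norm_mult)
    also have "\<dots> = cmod c * norm g"
      by (simp add: onorm_scaleR blinfun.bounded_linear_right norm_blinfun.rep_eq)
    finally show "norm (blinfun_compose (Blinfun ((*) c)) g) = cmod c * norm g" .
  qed
qed

end


section \<open>The algebras of analytic functions on the open unit ball\<close>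

definition analytic_on_ball :: "('a::complex_normed_vector \<Rightarrow> complex) \<Rightarrow> bool"
  where "analytic_on_ball f \<longleftrightarrow>
    (\<forall>x\<in>ball 0 1. \<exists>D. (f has_derivative D) (at x) \<and> (\<forall>c v. D (c *\<^sub>C v) = c * D v))"

text \<open>
  A function on the open unit ball is represented by its extension by zero to the whole space,
  so that every element of an algebra has exactly one representative and the algebra operations
  are the pointwise ones; the unit is the indicator of the ball.
\<close>

definition ball_restrict :: "('a::real_normed_vector \<Rightarrow> complex) \<Rightarrow> 'a \<Rightarrow> complex"
  where "ball_restrict f = (\<lambda>x. if x \<in> ball 0 1 then f x else 0)"

definition H_infinity :: "('a::complex_normed_vector \<Rightarrow> complex) set"
  where "H_infinity = {f. analytic_on_ball f \<and> bounded (f ` ball 0 1) \<and> (\<forall>x. x \<notin> ball 0 1 \<longrightarrow> f x = 0)}"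

definition A_u :: "('a::complex_normed_vector \<Rightarrow> complex) set"
  where "A_u = {f \<in> H_infinity. uniformly_continuous_on (ball 0 1) f}"

datatype algebra_kind = Kind_A_u | Kind_H_infinity

primrec ball_algebra :: "algebra_kind \<Rightarrow> ('a::complex_normed_vector \<Rightarrow> complex) set" where
  "ball_algebra Kind_A_u = A_u"
| "ball_algebra Kind_H_infinity = H_infinity"


section \<open>Multiplicative functionals, cluster sets and the cluster value theorem\<close>

text \<open>Only the values of a functional on the algebra \<open>H\<close> are relevant.\<close>

definition multiplicative_functional ::
    "('a \<Rightarrow> complex) set \<Rightarrow> (('a \<Rightarrow> complex) \<Rightarrow> complex) \<Rightarrow> bool"
  where "multiplicative_functional H \<tau> \<longleftrightarrow>
    (\<forall>f\<in>H. \<forall>g\<in>H. \<tau> (\<lambda>x. f x + g x) = \<tau> f + \<tau> g) \<and>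
    (\<forall>c. \<forall>f\<in>H. \<tau> (\<lambda>x. c * f x) = c * \<tau> f) \<and>
    (\<forall>f\<in>H. \<forall>g\<in>H. \<tau> (\<lambda>x. f x * g x) = \<tau> f * \<tau> g) \<and>
    (\<exists>f\<in>H. \<tau> f \<noteq> 0)"

definition fiber ::
    "('a::complex_normed_vector \<Rightarrow> complex) set \<Rightarrow> 'a cdual cdual \<Rightarrow> (('a \<Rightarrow> complex) \<Rightarrow> complex) set"
  where "fiber H \<phi> = {\<tau>. multiplicative_functional H \<tau> \<and>
    (\<forall>g :: 'a cdual. \<tau> (ball_restrict (cdual_apply g)) = cdual_apply \<phi> g)}"

text \<open>
  A net in the ball is represented by the filter of its tails. The lemmas
  \<open>cluster_set_memI_net\<close> and \<open>cluster_set_iff_net\<close> below relate this to nets over directed sets.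
\<close>

definition cluster_set ::
    "('a::complex_normed_vector \<Rightarrow> complex) \<Rightarrow> 'a cdual cdual \<Rightarrow> complex set"
  where "cluster_set f \<phi> = {z. \<exists>F. F \<noteq> bot \<and> (\<forall>\<^sub>F x in F. x \<in> ball 0 1) \<and>
    (\<forall>g :: 'a cdual. ((\<lambda>x. cdual_apply g x) \<longlongrightarrow> cdual_apply \<phi> g) F) \<and> (f \<longlongrightarrow> z) F}"

definition cluster_value_theorem_at ::
    "('a::complex_normed_vector \<Rightarrow> complex) set \<Rightarrow> 'a cdual cdual \<Rightarrow> bool"
  where "cluster_value_theorem_at H \<phi> \<longleftrightarrow> (\<forall>f\<in>H. {\<tau> f | \<tau>. \<tau> \<in> fiber H \<phi>} \<subseteq> cluster_set f \<phi>)"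

definition satisfies_cluster_value_theorem :: "'a::complex_normed_vector itself \<Rightarrow> algebra_kind \<Rightarrow> bool"
  where "satisfies_cluster_value_theorem X H \<longleftrightarrow>
    (\<forall>\<phi> :: 'a cdual cdual. norm \<phi> \<le> 1 \<longrightarrow> cluster_value_theorem_at (ball_algebra H) \<phi>)"


subsection \<open>Cluster sets in terms of nets\<close>

definition directed_set :: "'i set \<Rightarrow> ('i \<Rightarrow> 'i \<Rightarrow> bool) \<Rightarrow> bool"
  where "directed_set I le \<longleftrightarrow> I \<noteq> {} \<and> (\<forall>i\<in>I. le i i) \<and>
    (\<forall>i\<in>I. \<forall>j\<in>I. \<forall>k\<in>I. le i j \<longrightarrow> le j k \<longrightarrow> le i k) \<and>
    (\<forall>i\<in>I. \<forall>j\<in>I. \<exists>k\<in>I. le i k \<and> le j k)"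

definition net_tendsto ::
    "'i set \<Rightarrow> ('i \<Rightarrow> 'i \<Rightarrow> bool) \<Rightarrow> ('i \<Rightarrow> 'b::topological_space) \<Rightarrow> 'b \<Rightarrow> bool"
  where "net_tendsto I le y l \<longleftrightarrow>
    (\<forall>S. open S \<longrightarrow> l \<in> S \<longrightarrow> (\<exists>i\<in>I. \<forall>j\<in>I. le i j \<longrightarrow> y j \<in> S))"

lemma cluster_set_memI_net:
  fixes f :: "'a::complex_normed_vector \<Rightarrow> complex" and I :: "'i set"
  assumes dir: "directed_set I le"
    and ball: "\<And>i. i \<in> I \<Longrightarrow> x i \<in> ball 0 1"
    and weak: "\<And>g. net_tendsto I le (\<lambda>i. cdual_apply g (x i)) (cdual_apply \<phi> g)"
    and lim: "net_tendsto I le (\<lambda>i. f (x i)) z"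
  shows "z \<in> cluster_set f \<phi>"
proof -
  define G where "G = (INF i\<in>I. principal {j\<in>I. le i j})"
  have ev: "eventually P G \<longleftrightarrow> (\<exists>i\<in>I. \<forall>j\<in>I. le i j \<longrightarrow> P j)" for P
  proof -
    have "eventually P G \<longleftrightarrow> (\<exists>i\<in>I. eventually P (principal {j\<in>I. le i j}))"
      unfolding G_def
    proof (rule eventually_INF_base)
      show "I \<noteq> {}" using dir by (simp add: directed_set_def)
      fix i j assume "i \<in> I" "j \<in> I"
      then obtain k where k: "k \<in> I" "le i k" "le j k"
        using dir unfolding directed_set_def by meson
      have trans: "le a c" if "le a b" "le b c" "a \<in> I" "b \<in> I" "c \<in> I" for a b c
        using dir that unfolding directed_set_def by meson
      have "{l\<in>I. le k l} \<subseteq> {l\<in>I. le i l} \<inter> {l\<in>I. le j l}"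
        using trans[OF k(2)] trans[OF k(3)] \<open>i \<in> I\<close> \<open>j \<in> I\<close> k(1) by auto
      with k(1) show "\<exists>k\<in>I. principal {l\<in>I. le k l}
          \<le> inf (principal {l\<in>I. le i l}) (principal {l\<in>I. le j l})"
        by auto
    qed
    then show ?thesis by (auto simp: eventually_principal)
  qed
  have tend: "(y \<longlongrightarrow> l) G \<longleftrightarrow> net_tendsto I le y l" for y :: "'i \<Rightarrow> complex" and l
    by (simp add: tendsto_def net_tendsto_def ev)
  obtain i0 where i0: "i0 \<in> I" using dir unfolding directed_set_def by blast
  have refl: "le i i" if "i \<in> I" for i using dir that unfolding directed_set_def by blast
  have "\<not> eventually (\<lambda>_. False) G"
    unfolding ev using refl by blast
  then have "G \<noteq> bot" by (simp add: trivial_limit_def)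
  then have "filtermap x G \<noteq> bot" by (simp add: filtermap_bot_iff)
  moreover have "\<forall>\<^sub>F x in filtermap x G. x \<in> ball 0 1"
    unfolding eventually_filtermap ev using i0 ball by blast
  moreover have "((\<lambda>x. cdual_apply g x) \<longlongrightarrow> cdual_apply \<phi> g) (filtermap x G)" for g
    unfolding filterlim_filtermap tend by (rule weak)
  moreover have "(f \<longlongrightarrow> z) (filtermap x G)"
    unfolding filterlim_filtermap tend by (rule lim)
  ultimately show ?thesis
    unfolding cluster_set_def by blast
qed

lemma cluster_set_iff_net:
  fixes f :: "'a::complex_normed_vector \<Rightarrow> complex"
  shows "z \<in> cluster_set f \<phi> \<longleftrightarrow>
    (\<exists>(I :: ('a set \<times> 'a) set) le x. directed_set I le \<and> (\<forall>i\<in>I. x i \<in> ball 0 1) \<and>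
      (\<forall>g. net_tendsto I le (\<lambda>i. cdual_apply g (x i)) (cdual_apply \<phi> g)) \<and>
      net_tendsto I le (\<lambda>i. f (x i)) z)"
proof
  assume "z \<in> cluster_set f \<phi>"
  then obtain F where F: "F \<noteq> bot" "\<forall>\<^sub>F x in F. x \<in> ball 0 1"
      "\<And>g :: 'a cdual. ((\<lambda>x. cdual_apply g x) \<longlongrightarrow> cdual_apply \<phi> g) F" "(f \<longlongrightarrow> z) F"
    unfolding cluster_set_def by blast
  define I where "I = {(A, a). (\<forall>\<^sub>F x in F. x \<in> A) \<and> A \<subseteq> ball 0 1 \<and> a \<in> A}"
  define le :: "'a set \<times> 'a \<Rightarrow> 'a set \<times> 'a \<Rightarrow> bool" where "le = (\<lambda>i j. fst j \<subseteq> fst i)"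
  have ex: "\<exists>a. (A \<inter> ball 0 1, a) \<in> I" if "\<forall>\<^sub>F x in F. x \<in> A" for A
  proof -
    have "\<forall>\<^sub>F x in F. x \<in> A \<inter> ball 0 1" using that F(2) by eventually_elim auto
    moreover from this obtain a where "a \<in> A \<inter> ball 0 1"
      using F(1) eventually_happens' by blast
    ultimately show ?thesis by (auto simp: I_def)
  qed
  have "directed_set I le"
    unfolding directed_set_def
  proof (intro conjI ballI)
    show "I \<noteq> {}" using ex[of UNIV] by auto
    fix i j assume ij: "i \<in> I" "j \<in> I"
    then have "\<forall>\<^sub>F x in F. x \<in> fst i \<inter> fst j" by (auto simp: I_def eventually_conj_iff)
    from ex[OF this] obtain a where "(fst i \<inter> fst j \<inter> ball 0 1, a) \<in> I" by auto
    then show "\<exists>k\<in>I. le i k \<and> le j k" by (intro bexI) (auto simp: le_def)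
  qed (auto simp: le_def)
  moreover have "\<forall>i\<in>I. snd i \<in> ball 0 1" by (auto simp: I_def)
  moreover have tend: "net_tendsto I le (\<lambda>i. y (snd i)) l" if "(y \<longlongrightarrow> l) F" for y :: "'a \<Rightarrow> complex" and l
    unfolding net_tendsto_def
  proof (intro allI impI)
    fix S assume "open S" "l \<in> S"
    then have "\<forall>\<^sub>F x in F. x \<in> {x. y x \<in> S}" using that by (simp add: tendsto_def)
    from ex[OF this] obtain a where "({x. y x \<in> S} \<inter> ball 0 1, a) \<in> I" by auto
    then show "\<exists>i\<in>I. \<forall>j\<in>I. le i j \<longrightarrow> y (snd j) \<in> S"
      by (intro bexI[of _ "({x. y x \<in> S} \<inter> ball 0 1, a)"]) (auto simp: le_def I_def)
  qed
  ultimately show "\<exists>(I :: ('a set \<times> 'a) set) le x. directed_set I le \<and> (\<forall>i\<in>I. x i \<in> ball 0 1) \<and>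
      (\<forall>g. net_tendsto I le (\<lambda>i. cdual_apply g (x i)) (cdual_apply \<phi> g)) \<and>
      net_tendsto I le (\<lambda>i. f (x i)) z"
    by (intro exI[of _ I] exI[of _ le] exI[of _ snd] conjI allI tend F)
qed (elim exE conjE, rule cluster_set_memI_net, assumption, simp_all)


section \<open>The space of absolutely summable sequences\<close>

typedef ell1 = "{x :: nat \<Rightarrow> complex. summable (\<lambda>n. cmod (x n))}"
  by (rule exI[of _ "\<lambda>_. 0"]) auto

setup_lifting type_definition_ell1

instantiation ell1 :: complex_normed_vector
begin

lift_definition norm_ell1 :: "ell1 \<Rightarrow> real" is "\<lambda>x. \<Sum>n. cmod (x n)" .

lift_definition zero_ell1 :: ell1 is "\<lambda>_. 0"
  by simp

lift_definition plus_ell1 :: "ell1 \<Rightarrow> ell1 \<Rightarrow> ell1" is "\<lambda>x y n. x n + y n"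
  by (rule summable_comparison_test'[OF summable_add, where N = 0])
    (assumption, assumption, simp add: norm_triangle_ineq)

lift_definition minus_ell1 :: "ell1 \<Rightarrow> ell1 \<Rightarrow> ell1" is "\<lambda>x y n. x n - y n"
  by (rule summable_comparison_test'[OF summable_add, where N = 0])
    (assumption, assumption, simp add: norm_triangle_ineq4)

lift_definition uminus_ell1 :: "ell1 \<Rightarrow> ell1" is "\<lambda>x n. - x n"
  by simp

lift_definition scaleR_ell1 :: "real \<Rightarrow> ell1 \<Rightarrow> ell1" is "\<lambda>r x n. r *\<^sub>R x n"
  by (simp add: summable_mult)

lift_definition scaleC_ell1 :: "complex \<Rightarrow> ell1 \<Rightarrow> ell1" is "\<lambda>c x n. c * x n"
  by (simp add: norm_mult summable_mult)

definition dist_ell1 :: "ell1 \<Rightarrow> ell1 \<Rightarrow> real"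
  where "dist_ell1 x y = norm (x - y)"

definition sgn_ell1 :: "ell1 \<Rightarrow> ell1"
  where "sgn_ell1 x = inverse (norm x) *\<^sub>R x"

definition uniformity_ell1 :: "(ell1 \<times> ell1) filter"
  where "uniformity_ell1 = (INF e\<in>{0 <..}. principal {(x, y). dist x y < e})"

definition open_ell1 :: "ell1 set \<Rightarrow> bool"
  where "open_ell1 S = (\<forall>x\<in>S. \<forall>\<^sub>F (x', y) in uniformity. x' = x \<longrightarrow> y \<in> S)"

instance
proof
  fix x y z :: ell1 and r s :: real and c d :: complex
  show "dist x y = norm (x - y)" by (rule dist_ell1_def)
  show "sgn x = inverse (norm x) *\<^sub>R x" by (rule sgn_ell1_def)
  show "(uniformity :: (ell1 \<times> ell1) filter) = (INF e\<in>{0 <..}. principal {(x, y). dist x y < e})"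
    by (rule uniformity_ell1_def)
  show "open S = (\<forall>x\<in>S. \<forall>\<^sub>F (x', y) in uniformity. x' = x \<longrightarrow> y \<in> S)" for S :: "ell1 set"
    by (rule open_ell1_def)
  show "x + y + z = x + (y + z)" by transfer (simp add: algebra_simps)
  show "x + y = y + x" by transfer (simp add: algebra_simps)
  show "0 + x = x" by transfer simp
  show "- x + x = 0" by transfer simp
  show "x - y = x + - y" by transfer simp
  show "r *\<^sub>R (x + y) = r *\<^sub>R x + r *\<^sub>R y" by transfer (simp add: scaleR_add_right)
  show "(r + s) *\<^sub>R x = r *\<^sub>R x + s *\<^sub>R x" by transfer (simp add: scaleR_add_left)
  show "r *\<^sub>R s *\<^sub>R x = (r * s) *\<^sub>R x" by transfer simp
  show "1 *\<^sub>R x = x" by transfer simp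
  show "(norm x = 0) = (x = 0)" by transfer (auto simp: suminf_eq_zero_iff fun_eq_iff)
  show "norm (x + y) \<le> norm x + norm y"
  proof transfer
    fix x y :: "nat \<Rightarrow> complex"
    assume s: "summable (\<lambda>n. cmod (x n))" "summable (\<lambda>n. cmod (y n))"
    have "summable (\<lambda>n. cmod (x n + y n))"
      by (rule summable_comparison_test'[OF summable_add[OF s]]) (auto intro: norm_triangle_ineq)
    then have "(\<Sum>n. cmod (x n + y n)) \<le> (\<Sum>n. cmod (x n) + cmod (y n))"
      by (intro suminf_le summable_add s norm_triangle_ineq)
    then show "(\<Sum>n. cmod (x n + y n)) \<le> (\<Sum>n. cmod (x n)) + (\<Sum>n. cmod (y n))"
      by (simp add: suminf_add s)
  qed
  show "norm (r *\<^sub>R x) = \<bar>r\<bar> * norm x" by transfer (simp add: suminf_mult)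
  show "c *\<^sub>C (x + y) = c *\<^sub>C x + c *\<^sub>C y" by transfer (simp add: algebra_simps)
  show "(c + d) *\<^sub>C x = c *\<^sub>C x + d *\<^sub>C x" by transfer (simp add: algebra_simps)
  show "c *\<^sub>C d *\<^sub>C x = (c * d) *\<^sub>C x" by transfer (simp add: algebra_simps)
  show "complex_of_real r *\<^sub>C x = r *\<^sub>R x" by transfer (simp add: scaleR_conv_of_real)
  show "norm (c *\<^sub>C x) = cmod c * norm x" by transfer (simp add: norm_mult suminf_mult)
qed

end


section \<open>The space of integrable functions on the unit interval\<close>

abbreviation unit_interval :: "real measure"
  where "unit_interval \<equiv> lebesgue_on {0<..<1}"

quotient_type L1 = "real \<Rightarrow> complex" / partial:
  "\<lambda>f g. integrable unit_interval f \<and> integrable unit_interval g \<and> (AE t in unit_interval. f t = g t)"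
proof (rule part_equivpI)
  show "\<exists>f :: real \<Rightarrow> complex. integrable unit_interval f \<and> integrable unit_interval f \<and>
      (AE t in unit_interval. f t = f t)"
    by (rule exI[of _ "\<lambda>_. 0"]) simp
qed (auto intro!: sympI transpI elim: AE_mp)

instantiation L1 :: complex_normed_vector
begin

lift_definition norm_L1 :: "L1 \<Rightarrow> real" is "\<lambda>f. \<integral>t. cmod (f t) \<partial>unit_interval"
  by (auto intro!: integral_cong_AE)

lift_definition zero_L1 :: L1 is "\<lambda>_. 0"
  by simp

lift_definition plus_L1 :: "L1 \<Rightarrow> L1 \<Rightarrow> L1" is "\<lambda>f g t. f t + g t"
  by auto

lift_definition minus_L1 :: "L1 \<Rightarrow> L1 \<Rightarrow> L1" is "\<lambda>f g t. f t - g t"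
  by auto

lift_definition uminus_L1 :: "L1 \<Rightarrow> L1" is "\<lambda>f t. - f t"
  by auto

lift_definition scaleR_L1 :: "real \<Rightarrow> L1 \<Rightarrow> L1" is "\<lambda>r f t. r *\<^sub>R f t"
  by auto

lift_definition scaleC_L1 :: "complex \<Rightarrow> L1 \<Rightarrow> L1" is "\<lambda>c f t. c * f t"
  by auto

definition dist_L1 :: "L1 \<Rightarrow> L1 \<Rightarrow> real"
  where "dist_L1 f g = norm (f - g)"

definition sgn_L1 :: "L1 \<Rightarrow> L1"
  where "sgn_L1 f = inverse (norm f) *\<^sub>R f"

definition uniformity_L1 :: "(L1 \<times> L1) filter"
  where "uniformity_L1 = (INF e\<in>{0 <..}. principal {(x, y). dist x y < e})"

definition open_L1 :: "L1 set \<Rightarrow> bool"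
  where "open_L1 S = (\<forall>x\<in>S. \<forall>\<^sub>F (x', y) in uniformity. x' = x \<longrightarrow> y \<in> S)"

instance
proof
  fix f g h :: L1 and r s :: real and c d :: complex
  show "dist f g = norm (f - g)" by (rule dist_L1_def)
  show "sgn f = inverse (norm f) *\<^sub>R f" by (rule sgn_L1_def)
  show "(uniformity :: (L1 \<times> L1) filter) = (INF e\<in>{0 <..}. principal {(x, y). dist x y < e})"
    by (rule uniformity_L1_def)
  show "open S = (\<forall>x\<in>S. \<forall>\<^sub>F (x', y) in uniformity. x' = x \<longrightarrow> y \<in> S)" for S :: "L1 set"
    by (rule open_L1_def)
  show "f + g + h = f + (g + h)" by transfer (auto simp: algebra_simps)
  show "f + g = g + f" by transfer (auto simp: algebra_simps)
  show "0 + f = f" by transfer auto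
  show "- f + f = 0" by transfer auto
  show "f - g = f + - g" by transfer auto
  show "r *\<^sub>R (f + g) = r *\<^sub>R f + r *\<^sub>R g" by transfer (auto simp: scaleR_add_right)
  show "(r + s) *\<^sub>R f = r *\<^sub>R f + s *\<^sub>R f" by transfer (auto simp: scaleR_add_left)
  show "r *\<^sub>R s *\<^sub>R f = (r * s) *\<^sub>R f" by transfer auto
  show "1 *\<^sub>R f = f" by transfer auto
  show "(norm f = 0) = (f = 0)"
    by transfer (simp add: integral_nonneg_eq_0_iff_AE)
  show "norm (f + g) \<le> norm f + norm g"
  proof transfer
    fix f g :: "real \<Rightarrow> complex"
    assume "integrable unit_interval f \<and> integrable unit_interval f \<and> (AE t in unit_interval. f t = f t)"
      and "integrable unit_interval g \<and> integrable unit_interval g \<and> (AE t in unit_interval. g t = g t)"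
    then have fg: "integrable unit_interval f" "integrable unit_interval g" by auto
    have "(\<integral>t. cmod (f t + g t) \<partial>unit_interval) \<le> (\<integral>t. cmod (f t) + cmod (g t) \<partial>unit_interval)"
      using fg by (intro integral_mono) (auto intro: norm_triangle_ineq)
    then show "(\<integral>t. cmod (f t + g t) \<partial>unit_interval)
        \<le> (\<integral>t. cmod (f t) \<partial>unit_interval) + (\<integral>t. cmod (g t) \<partial>unit_interval)"
      using fg by simp
  qed
  show "norm (r *\<^sub>R f) = \<bar>r\<bar> * norm f" by transfer simp
  show "c *\<^sub>C (f + g) = c *\<^sub>C f + c *\<^sub>C g" by transfer (auto simp: algebra_simps)
  show "(c + d) *\<^sub>C f = c *\<^sub>C f + d *\<^sub>C f" by transfer (auto simp: algebra_simps)
  show "c *\<^sub>C d *\<^sub>C f = (c * d) *\<^sub>C f" by transfer (auto simp: algebra_simps)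
  show "complex_of_real r *\<^sub>C f = r *\<^sub>R f" by transfer (auto simp: scaleR_conv_of_real)
  show "norm (c *\<^sub>C f) = cmod c * norm f" by transfer (simp add: norm_mult)
qed

end

end

theory Submission
  imports Defs "HOL-Complex_Analysis.Cauchy_Integral_Formula"
begin

text \<open>
  The space \<open>L1\<close> is approximated from inside by copies of finite-dimensional \<open>\<ell>\<^sub>1\<close> spaces: integrating a
  function over the \<open>n + 1\<close> equal subintervals of the unit interval gives \<open>n + 1\<close> coefficients, and
  these form the \<open>n\<close>-th of countably many disjoint blocks of a sequence. This is a contraction
  \<open>S\<^sub>n\<close> from \<open>L1\<close> to \<open>\<ell>\<^sub>1\<close> (\<open>analysis\<close>). In the other direction a single contraction \<open>Q\<close> from
  \<open>\<ell>\<^sub>1\<close> to \<open>L1\<close> (\<open>synthesis\<close>) sends each unit vector to the normalised indicator of its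
  subinterval. Then \<open>Q (S\<^sub>n f)\<close> is the average of \<open>f\<close> over the subintervals, and it tends to \<open>f\<close> in
  the norm (\<open>synthesis_analysis_tendsto\<close>).

  These maps carry the cluster value theorem from \<open>\<ell>\<^sub>1\<close> to \<open>L1\<close>, and indeed from \<open>Y\<close> to \<open>X\<close> whenever
  such contractions exist (\<open>cluster_value_theorem_transfer\<close>). Let \<open>\<tau>\<close> be a multiplicative functional
  in the fibre over \<open>\<phi>\<close>. Along a filter on the natural numbers that makes all bounded sequences
  converge, \<open>(T g) x = lim g (S\<^sub>n x)\<close> defines an algebra homomorphism \<open>T\<close> from the algebra on the ball
  of \<open>Y\<close> to the one on the ball of \<open>X\<close>; that \<open>T g\<close> is again analytic follows from Cauchy estimates,
  which are uniform in \<open>n\<close> (\<open>analytic_on_ball_limit\<close>). As the \<open>S\<^sub>n\<close> are linear, \<open>T\<close> maps functionals to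
  functionals, so \<open>\<tau> \<circ> T\<close> lies in the fibre over the point \<open>\<psi> = \<phi> \<circ> T\<close> of the bidual ball of \<open>Y\<close>. Since
  \<open>Q (S\<^sub>n x) \<longlonglongrightarrow> x\<close>, one has \<open>T (h \<circ> Q) = h\<close>; hence \<open>\<tau> h\<close> is the value of \<open>\<tau> \<circ> T\<close> at \<open>h \<circ> Q\<close> and, by
  assumption, a cluster value of \<open>h \<circ> Q\<close> at \<open>\<psi>\<close>. The image under \<open>Q\<close> of a net that witnesses this
  converges to \<open>\<phi>\<close>, and \<open>h\<close> tends to \<open>\<tau> h\<close> along it.
\<close>


section \<open>Bounded functionals and complex linear contractions\<close>

lemma scaleC_0 [simp]: "0 *\<^sub>C (x :: 'a::complex_normed_vector) = 0"
  by (metis norm_scaleC norm_zero mult_zero_left norm_eq_zero)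

lemma bounded_linear_scaleC_left:
  "bounded_linear (\<lambda>c. c *\<^sub>C (x :: 'a::complex_normed_vector))"
proof (rule bounded_linear_intro)
  fix c d :: complex and r :: real
  show "(c + d) *\<^sub>C x = c *\<^sub>C x + d *\<^sub>C x" by (rule scaleC_add_left)
  show "(r *\<^sub>R c) *\<^sub>C x = r *\<^sub>R c *\<^sub>C x"
    by (simp add: scaleR_conv_of_real scaleC_scaleC flip: scaleC_of_real)
  show "norm (c *\<^sub>C x) \<le> norm c * norm x" by (simp add: norm_scaleC)
qed

lemma cdual_apply_add_left: "cdual_apply (g + h) x = cdual_apply g x + cdual_apply h x"
  by (simp add: cdual_apply_def plus_cdual.rep_eq blinfun.add_left)

lemma cdual_apply_scaleC_left: "cdual_apply (c *\<^sub>C g) x = c * cdual_apply g x"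
  by (simp add: cdual_apply_def scaleC_cdual.rep_eq bounded_linear_Blinfun_apply
      bounded_linear_mult_right)

lemma cdual_apply_add_right: "cdual_apply g (x + y) = cdual_apply g x + cdual_apply g y"
  by (simp add: cdual_apply_def blinfun.add_right)

lemma cdual_apply_scaleC_right: "cdual_apply g (c *\<^sub>C x) = c * cdual_apply g x"
  using Rep_cdual[of g] by (simp add: cdual_apply_def)

lemma norm_cdual_apply_le: "cmod (cdual_apply g x) \<le> norm g * norm x"
  by (simp add: cdual_apply_def norm_cdual.rep_eq norm_blinfun)

lemma cdual_eqI: "(\<And>x. cdual_apply g x = cdual_apply h x) \<Longrightarrow> g = h"
  by (metis Rep_cdual_inject blinfun_eqI cdual_apply_def)

definition cdual_of :: "('a::complex_normed_vector \<Rightarrow> complex) \<Rightarrow> 'a cdual"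
  where "cdual_of L = Abs_cdual (Blinfun L)"

lemma cdual_of:
  fixes L :: "'a::complex_normed_vector \<Rightarrow> complex"
  assumes add: "\<And>x y. L (x + y) = L x + L y"
    and scale: "\<And>c x. L (c *\<^sub>C x) = c * L x"
    and bound: "\<And>x. cmod (L x) \<le> K * norm x" and "0 \<le> K"
  shows cdual_apply_cdual_of: "cdual_apply (cdual_of L) = L"
    and norm_cdual_of_le: "norm (cdual_of L) \<le> K"
proof -
  have "bounded_linear L"
  proof (rule bounded_linear_intro)
    show "L (r *\<^sub>R x) = r *\<^sub>R L x" for r x
      using scale[of "of_real r" x] by (simp add: scaleC_of_real scaleR_conv_of_real)
  qed (use add bound in \<open>auto simp: mult.commute\<close>)
  then have L: "blinfun_apply (Blinfun L) = L" by (rule bounded_linear_Blinfun_apply)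
  then have Rep: "Rep_cdual (cdual_of L) = Blinfun L"
    unfolding cdual_of_def by (intro Abs_cdual_inverse) (simp add: scale)
  show "cdual_apply (cdual_of L) = L" by (simp add: cdual_apply_def Rep L)
  show "norm (cdual_of L) \<le> K"
    unfolding norm_cdual.rep_eq Rep by (rule norm_blinfun_bound) (use assms L in auto)
qed

definition clinear_contraction ::
    "('a::complex_normed_vector \<Rightarrow> 'b::complex_normed_vector) \<Rightarrow> bool"
  where "clinear_contraction T \<longleftrightarrow> (\<forall>x y. T (x + y) = T x + T y) \<and>
    (\<forall>c x. T (c *\<^sub>C x) = c *\<^sub>C T x) \<and> (\<forall>x. norm (T x) \<le> norm x)"

lemma clinear_contractionD:
  assumes "clinear_contraction T"
  shows "T (x + y) = T x + T y" "T (c *\<^sub>C x) = c *\<^sub>C T x" "norm (T x) \<le> norm x"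
  using assms by (auto simp: clinear_contraction_def)

lemma clinear_contraction_bounded_linear:
  assumes "clinear_contraction T" shows "bounded_linear T"
proof (rule bounded_linear_intro[where K = 1])
  show "T (r *\<^sub>R x) = r *\<^sub>R T x" for r x
    using clinear_contractionD(2)[OF assms, of "of_real r" x] by (simp add: scaleC_of_real)
qed (use assms in \<open>auto simp: clinear_contraction_def\<close>)

lemma clinear_contraction_ball:
  assumes "clinear_contraction T" "x \<in> ball 0 1" shows "T x \<in> ball 0 1"
  using clinear_contractionD(3)[OF assms(1), of x] assms(2) by simp

lemma clinear_contraction_dist:
  assumes "clinear_contraction T" shows "dist (T x) (T y) \<le> dist x y"
  using clinear_contractionD(3)[OF assms, of "x - y"]
    linear_diff[OF bounded_linear.linear[OF clinear_contraction_bounded_linear[OF assms]]]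
  by (simp add: dist_norm)

lemma H_infinity_bound:
  assumes "g \<in> H_infinity"
  obtains M where "M > 0" "\<And>x. cmod (g x) \<le> M"
proof -
  obtain M where "M > 0" "\<forall>y \<in> g ` ball 0 1. cmod y \<le> M"
    using assms bounded_pos unfolding H_infinity_def by blast
  moreover have "g x = 0" if "x \<notin> ball 0 1" for x
    using assms that by (simp add: H_infinity_def)
  ultimately show ?thesis
    by (metis imageI less_imp_le norm_zero that)
qed

lemma ball_algebra_subset_H_infinity: "ball_algebra H \<subseteq> H_infinity"
  by (cases H) (auto simp: A_u_def)

lemma analytic_on_ball_cong:
  assumes "analytic_on_ball f" "\<And>x. x \<in> ball 0 1 \<Longrightarrow> f x = g x"
  shows "analytic_on_ball g"
  unfolding analytic_on_ball_def
proof
  fix x :: 'a assume x: "x \<in> ball 0 1"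
  then obtain D where D: "(f has_derivative D) (at x)" "\<forall>c v. D (c *\<^sub>C v) = c * D v"
    using assms(1) unfolding analytic_on_ball_def by blast
  have "(g has_derivative D) (at x)"
    by (rule has_derivative_transform_within_open[OF D(1) open_ball x assms(2)])
  with D(2) show "\<exists>D. (g has_derivative D) (at x) \<and> (\<forall>c v. D (c *\<^sub>C v) = c * D v)" by blast
qed

lemma analytic_on_ball_compose:
  fixes T :: "'a::complex_normed_vector \<Rightarrow> 'b::complex_normed_vector"
  assumes "analytic_on_ball g" "clinear_contraction T"
  shows "analytic_on_ball (\<lambda>x. g (T x))"
  unfolding analytic_on_ball_def
proof
  fix x :: 'a assume "x \<in> ball 0 1"
  then obtain D where D: "(g has_derivative D) (at (T x))" "\<forall>c v. D (c *\<^sub>C v) = c * D v"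
    using assms clinear_contraction_ball unfolding analytic_on_ball_def by blast
  have "(T has_derivative T) (at x)"
    by (rule bounded_linear_imp_has_derivative[OF clinear_contraction_bounded_linear[OF assms(2)]])
  from has_derivative_compose[OF this D(1)]
  have "((\<lambda>x. g (T x)) has_derivative (\<lambda>v. D (T v))) (at x)" by simp
  moreover have "D (T (c *\<^sub>C v)) = c * D (T v)" for c v
    using D(2) assms(2) by (simp add: clinear_contractionD)
  ultimately show "\<exists>D. ((\<lambda>x. g (T x)) has_derivative D) (at x) \<and> (\<forall>c v. D (c *\<^sub>C v) = c * D v)"
    by blast
qed

section \<open>Pointwise limits of bounded analytic functions\<close>

text \<open>
  The Cauchy inequality bounds the second derivative on the disc of radius \<open>R / 2\<close> by way of discs of
  radius \<open>R / 4\<close>, and Taylor's formula turns this into a quadratic remainder. The constants involve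
  the function only through its bound \<open>M\<close>.
\<close>

lemma holomorphic_taylor_remainder:
  assumes hol: "\<phi> holomorphic_on ball 0 R" and R: "0 < R"
    and M: "\<And>z. z \<in> ball 0 R \<Longrightarrow> cmod (\<phi> z) \<le> M"
  shows "cmod (deriv \<phi> 0) \<le> 2 * M / R"
    and "cmod \<zeta> < R / 2 \<Longrightarrow> cmod (\<phi> \<zeta> - \<phi> 0 - deriv \<phi> 0 * \<zeta>) \<le> 32 * M / R\<^sup>2 * (cmod \<zeta>)\<^sup>2"
proof -
  have "cmod ((deriv ^^ 1) \<phi> 0) \<le> fact 1 * M / (R/2) ^ 1"
  proof (rule Cauchy_inequality)
    show "\<phi> holomorphic_on ball 0 (R / 2)"
      using R by (intro holomorphic_on_subset[OF hol]) auto
    show "continuous_on (cball 0 (R / 2)) \<phi>"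
      using R by (intro holomorphic_on_imp_continuous_on holomorphic_on_subset[OF hol]) auto
  qed (use R in \<open>auto intro!: M\<close>)
  then show "cmod (deriv \<phi> 0) \<le> 2 * M / R" by (simp add: mult.commute)
next
  assume \<zeta>: "cmod \<zeta> < R / 2"
  have B: "cmod ((deriv ^^ 2) \<phi> z) \<le> 32 * M / R\<^sup>2" if z: "z \<in> ball 0 (R/2)" for z
  proof -
    have sub: "cball z (R/4) \<subseteq> ball 0 R"
    proof
      fix w assume "w \<in> cball z (R/4)"
      then have "cmod (w - z) \<le> R/4" by (simp add: dist_norm norm_minus_commute)
      then have "cmod w \<le> cmod z + R/4" using norm_triangle_sub[of w z] by linarith
      then show "w \<in> ball 0 R" using z R by simp
    qed
    have "cmod ((deriv ^^ 2) \<phi> z) \<le> fact 2 * M / (R/4) ^ 2"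
    proof (rule Cauchy_inequality)
      show "\<phi> holomorphic_on ball z (R / 4)"
        using sub by (intro holomorphic_on_subset[OF hol]) auto
      show "continuous_on (cball z (R / 4)) \<phi>"
        using sub by (intro holomorphic_on_imp_continuous_on holomorphic_on_subset[OF hol]) auto
      show "cmod (\<phi> x) \<le> M" if "cmod (z - x) = R / 4" for x
        using sub that by (intro M) (auto simp: dist_norm)
    qed (use R in auto)
    then show ?thesis by (simp add: power2_eq_square)
  qed
  have "cmod ((deriv ^^ 0) \<phi> \<zeta> - (\<Sum>i\<le>1. (deriv ^^ i) \<phi> 0 * (\<zeta> - 0) ^ i / fact i))
      \<le> 32 * M / R\<^sup>2 * cmod (\<zeta> - 0) ^ Suc 1 / fact 1"
  proof (rule complex_Taylor[where S = "ball 0 (R/2)" and f = "\<lambda>i. (deriv ^^ i) \<phi>"])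
    fix i z assume z: "z \<in> ball (0::complex) (R/2)"
    have "(deriv ^^ i) \<phi> holomorphic_on ball 0 R"
      by (rule holomorphic_higher_deriv[OF hol open_ball])
    then have "((deriv ^^ i) \<phi> has_field_derivative deriv ((deriv ^^ i) \<phi>) z) (at z)"
      using z R by (intro holomorphic_derivI[where S = "ball 0 R"]) auto
    then show "((deriv ^^ i) \<phi> has_field_derivative (deriv ^^ Suc i) \<phi> z) (at z within ball 0 (R/2))"
      by (simp add: has_field_derivative_at_within)
  qed (use R \<zeta> B in \<open>auto simp: numeral_2_eq_2\<close>)
  then show "cmod (\<phi> \<zeta> - \<phi> 0 - deriv \<phi> 0 * \<zeta>) \<le> 32 * M / R\<^sup>2 * (cmod \<zeta>)\<^sup>2"
    by (simp add: power2_eq_square algebra_simps)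
qed

text \<open>
  Restricting \<open>g\<close> to the complex line through \<open>x\<close> in direction \<open>h\<close> reduces the estimates to one
  variable. That the bounds depend on \<open>g\<close> only through \<open>M\<close> makes differentiability survive pointwise
  limits.
\<close>

lemma analytic_on_ball_derivative_bounds:
  fixes g :: "'a::complex_normed_vector \<Rightarrow> complex"
  assumes g: "analytic_on_ball g" and M: "\<And>x. x \<in> ball 0 1 \<Longrightarrow> cmod (g x) \<le> M"
    and x: "norm x < 1"
  obtains D where "bounded_linear D" "\<And>c v. D (c *\<^sub>C v) = c * D v"
    "\<And>h. cmod (D h) \<le> 2 * M / (1 - norm x) * norm h"
    "\<And>h. norm h < (1 - norm x) / 2 \<Longrightarrow>
        cmod (g (x + h) - g x - D h) \<le> 32 * M / (1 - norm x)\<^sup>2 * (norm h)\<^sup>2"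
proof -
  define r where "r = 1 - norm x"
  have r: "r > 0" using x by (simp add: r_def)
  have "x \<in> ball 0 1" using x by simp
  then obtain D where D: "(g has_derivative D) (at x)" and Dc: "\<And>c v. D (c *\<^sub>C v) = c * D v"
    using g unfolding analytic_on_ball_def by blast
  have lin: "bounded_linear D" using D by (rule has_derivative_bounded_linear)
  have ineq: "cmod (D h) \<le> 2 * M / r * norm h \<and>
      (norm h < r / 2 \<longrightarrow> cmod (g (x + h) - g x - D h) \<le> 32 * M / r\<^sup>2 * (norm h)\<^sup>2)" for h
  proof (cases "h = 0")
    case True
    then show ?thesis using linear_0[OF bounded_linear.linear[OF lin]] by simp
  next
    case False
    (* the line x + z h stays in the ball for cmod z < R; the estimates are used at z = 1 *)
    define R where "R = r / norm h"
    have R: "R > 0" using r False by (simp add: R_def)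
    define \<phi> where "\<phi> = (\<lambda>\<zeta>. g (x + \<zeta> *\<^sub>C h))"
    have inball: "x + \<zeta> *\<^sub>C h \<in> ball 0 1" if "\<zeta> \<in> ball 0 R" for \<zeta>
    proof -
      have "norm (\<zeta> *\<^sub>C h) < r" using that False by (simp add: norm_scaleC R_def field_simps)
      then show ?thesis using norm_triangle_ineq[of x "\<zeta> *\<^sub>C h"] by (simp add: r_def)
    qed
    have line: "((\<lambda>\<zeta>. x + \<zeta> *\<^sub>C h) has_derivative (\<lambda>v. v *\<^sub>C h)) (at \<zeta>)" for \<zeta>
      using has_derivative_add[OF has_derivative_const[of x]
          bounded_linear_imp_has_derivative[OF bounded_linear_scaleC_left[of h]]]
      by simp
    have deriv: "(\<phi> has_field_derivative E h) (at \<zeta>)"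
      if "(g has_derivative E) (at (x + \<zeta> *\<^sub>C h))" "\<And>c v. E (c *\<^sub>C v) = c * E v" for \<zeta> E
      using has_derivative_compose[OF line that(1)] that(2)
      unfolding \<phi>_def has_field_derivative_def by (simp add: mult_commute_abs)
    have hol: "\<phi> holomorphic_on ball 0 R"
      unfolding holomorphic_on_def field_differentiable_def
      using inball g deriv unfolding analytic_on_ball_def
      by (meson has_field_derivative_at_within)
    have bd: "cmod (\<phi> z) \<le> M" if "z \<in> ball 0 R" for z
      unfolding \<phi>_def using inball[OF that] by (rule M)
    have d0: "deriv \<phi> 0 = D h"
      by (rule DERIV_imp_deriv, rule deriv) (use D Dc in auto)
    have one: "1 *\<^sub>C h = h" using scaleC_of_real[of 1 h] by simp
    have "cmod (D h) \<le> 2 * M / R"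
      using holomorphic_taylor_remainder(1)[OF hol R bd] by (simp add: d0)
    moreover have "cmod (g (x + h) - g x - D h) \<le> 32 * M / R\<^sup>2" if "norm h < r / 2"
    proof -
      have "cmod 1 < R / 2" using that False by (simp add: R_def field_simps)
      then have "cmod (\<phi> 1 - \<phi> 0 - D h * 1) \<le> 32 * M / R\<^sup>2 * (cmod 1)\<^sup>2"
        using holomorphic_taylor_remainder(2)[OF hol R bd] unfolding d0 by blast
      then show ?thesis by (simp add: \<phi>_def one)
    qed
    ultimately show ?thesis by (simp add: R_def power_divide)
  qed
  show ?thesis by (rule that[of D]) (use lin Dc ineq in \<open>auto simp: r_def\<close>)
qed

text \<open>
  Such filters play the part of free ultrafilters: limits along them are multiplicative and exist
  for all bounded sequences.
\<close>

definition compactifying :: "nat filter \<Rightarrow> bool"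
  where "compactifying U \<longleftrightarrow> U \<noteq> bot \<and> U \<le> sequentially \<and>
    (\<forall>a :: nat \<Rightarrow> complex. bounded (range a) \<longrightarrow> (\<exists>l. (a \<longlongrightarrow> l) U))"

text \<open>
  The evaluations \<open>a \<mapsto> a n\<close> are points of a product of compact sets, indexed by all
  sequences \<open>a\<close>. By Tychonoff's theorem they cluster at some point \<open>p\<close>; the filter generated by the
  neighbourhoods of \<open>p\<close> forces every bounded \<open>a\<close> to converge to \<open>p a\<close>.
\<close>

lemma ex_compactifying: "\<exists>U. compactifying U"
proof -
  (* unbounded sequences are sent to 0, so that every factor of the product is compact *)
  define ev :: "nat \<Rightarrow> (nat \<Rightarrow> complex) \<Rightarrow> complex"
    where "ev = (\<lambda>n a. if bounded (range a) then a n else 0)"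
  define K where "K = (\<Pi>\<^sub>E a\<in>UNIV. closure (range (\<lambda>n. ev n a)))"
  have "bounded (range (\<lambda>n. ev n a))" for a
    by (cases "bounded (range a)") (auto simp: ev_def image_constant_conv)
  then have "compact (closure (range (\<lambda>n. ev n a)))" for a
    by (rule compact_closure[THEN iffD2])
  then have "compactin (product_topology (\<lambda>a. euclidean) UNIV) K"
    unfolding K_def compactin_PiE by simp
  then have K: "compact K" by (simp add: euclidean_product_topology)
  have "eventually (\<lambda>p. p \<in> K) (filtermap ev sequentially)"
    unfolding eventually_filtermap K_def
    by (intro always_eventually allI PiE_I) (auto intro: closure_subset[THEN subsetD])
  then obtain p where p: "inf (nhds p) (filtermap ev sequentially) \<noteq> bot"
    using K unfolding compact_filter
    by (metis filtermap_bot_iff trivial_limit_sequentially)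
  define U where "U = inf (filtercomap ev (nhds p)) sequentially"
  have "U \<noteq> bot"
  proof
    assume "U = bot"
    then have "eventually (\<lambda>n. False) U" by simp
    then obtain P R where PR: "eventually P (filtercomap ev (nhds p))"
        "eventually R sequentially" "\<And>n. P n \<Longrightarrow> R n \<Longrightarrow> False"
      unfolding U_def eventually_inf by blast
    then obtain P' where P': "eventually P' (nhds p)" "\<And>n. P' (ev n) \<Longrightarrow> P n"
      unfolding eventually_filtercomap by blast
    have "eventually (\<lambda>q. \<not> P' q) (filtermap ev sequentially)"
      unfolding eventually_filtermap using PR P' by (auto elim!: eventually_mono)
    with P'(1) have "eventually (\<lambda>_. False) (inf (nhds p) (filtermap ev sequentially))"
      unfolding eventually_inf by blast
    with p show False by (simp add: trivial_limit_def)
  qed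
  moreover have "U \<le> sequentially" by (simp add: U_def)
  moreover have "(a \<longlongrightarrow> p a) U" if "bounded (range a)" for a
  proof -
    have lim: "filterlim ev (nhds p) U"
      unfolding U_def by (rule filterlim_mono[OF filterlim_filtercomap]) auto
    have "((\<lambda>n. ev n a) \<longlongrightarrow> p a) U"
    proof (rule topological_tendstoI)
      fix W :: "complex set" assume "open W" "p a \<in> W"
      moreover have "open ((\<lambda>q :: (nat \<Rightarrow> complex) \<Rightarrow> complex. q a) -` W)"
        using \<open>open W\<close> continuous_on_product_coordinates by (rule open_vimage)
      ultimately have "\<forall>\<^sub>F q in nhds p. q a \<in> W"
        unfolding eventually_nhds by blast
      then show "\<forall>\<^sub>F n in U. ev n a \<in> W"
        using lim by (rule filterlim_iff[THEN iffD1, rule_format, rotated])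
    qed
    with that show ?thesis by (simp add: ev_def)
  qed
  ultimately show ?thesis unfolding compactifying_def by blast
qed

lemma compactifying_tendsto_Lim:
  fixes a :: "nat \<Rightarrow> complex"
  assumes "compactifying U" "\<And>n. cmod (a n) \<le> B"
  shows "(a \<longlongrightarrow> Lim U a) U"
proof -
  have "bounded (range a)" using assms(2) by (auto intro: boundedI)
  then obtain l where "(a \<longlongrightarrow> l) U" using assms(1) unfolding compactifying_def by blast
  then show ?thesis using assms(1) tendsto_Lim unfolding compactifying_def by metis
qed

lemma compactifying_Lim_eqI:
  assumes "compactifying U" "(a \<longlongrightarrow> l) U" shows "Lim U a = l"
  using assms tendsto_Lim unfolding compactifying_def by blast

text \<open>
  The derivatives \<open>D n\<close> at a point are bounded uniformly in \<open>n\<close>, so they have a limit \<open>E\<close> along \<open>U\<close>,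
  and the uniform quadratic remainder passes to the limit and shows that \<open>E\<close> is the derivative of \<open>G\<close>.
\<close>

lemma analytic_on_ball_limit:
  fixes g :: "nat \<Rightarrow> 'a::complex_normed_vector \<Rightarrow> complex"
  assumes U: "compactifying U" and g: "\<And>n. analytic_on_ball (g n)"
    and M: "\<And>n x. x \<in> ball 0 1 \<Longrightarrow> cmod (g n x) \<le> M"
    and lim: "\<And>x. x \<in> ball 0 1 \<Longrightarrow> ((\<lambda>n. g n x) \<longlongrightarrow> G x) U"
  shows "analytic_on_ball G"
  unfolding analytic_on_ball_def
proof
  have ne: "U \<noteq> bot" using U by (simp add: compactifying_def)
  fix x :: 'a assume "x \<in> ball 0 1"
  then have x: "norm x < 1" by simp
  define r where "r = 1 - norm x"
  have r: "r > 0" using x by (simp add: r_def)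
  have "\<exists>D. bounded_linear D \<and> (\<forall>c v. D (c *\<^sub>C v) = c * D v) \<and>
      (\<forall>h. cmod (D h) \<le> 2 * M / r * norm h) \<and>
      (\<forall>h. norm h < r / 2 \<longrightarrow>
        cmod (g n (x + h) - g n x - D h) \<le> 32 * M / r\<^sup>2 * (norm h)\<^sup>2)" for n
    using analytic_on_ball_derivative_bounds[OF g M x, of n] unfolding r_def by metis
  then obtain D where Dlin: "\<And>n. bounded_linear (D n)"
      and Dc: "\<And>n c v. D n (c *\<^sub>C v) = c * D n v"
      and Db: "\<And>n h. cmod (D n h) \<le> 2 * M / r * norm h"
      and Dg: "\<And>n h. norm h < r / 2 \<Longrightarrow>
        cmod (g n (x + h) - g n x - D n h) \<le> 32 * M / r\<^sup>2 * (norm h)\<^sup>2"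
    by metis
  define E where "E = (\<lambda>h. Lim U (\<lambda>n. D n h))"
  have DE: "((\<lambda>n. D n h) \<longlongrightarrow> E h) U" for h
    unfolding E_def by (rule compactifying_tendsto_Lim[OF U Db])
  have Eeq: "E h = l" if "((\<lambda>n. D n h) \<longlongrightarrow> l) U" for h l
    using tendsto_unique[OF ne DE that] .
  have Ec: "E (c *\<^sub>C v) = c * E v" for c v
    by (rule Eeq) (simp add: Dc tendsto_mult_left DE)
  have Elin: "bounded_linear E"
  proof (rule bounded_linear_intro[where K = "2 * M / r"])
    show "E (v + w) = E v + E w" for v w
      by (rule Eeq) (simp add: linear_add[OF bounded_linear.linear[OF Dlin]] tendsto_add DE)
    show "E (s *\<^sub>R v) = s *\<^sub>R E v" for s v
      using Ec[of "of_real s" v] by (simp add: scaleC_of_real scaleR_conv_of_real)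
    show "cmod (E v) \<le> norm v * (2 * M / r)" for v
      by (rule tendsto_upperbound[OF tendsto_norm[OF DE] _ ne])
        (use Db[of _ v] in \<open>auto simp: mult.commute\<close>)
  qed
  define C where "C = 32 * M / r\<^sup>2"
  have main: "cmod (G (x + h) - G x - E h) \<le> C * (norm h)\<^sup>2" if h: "norm h < r / 2" for h
  proof -
    have xh: "x + h \<in> ball 0 1"
      using norm_triangle_ineq[of x h] h r by (simp add: r_def)
    have "((\<lambda>n. cmod (g n (x + h) - g n x - D n h)) \<longlongrightarrow> cmod (G (x + h) - G x - E h)) U"
      using x by (intro tendsto_norm tendsto_diff lim DE xh) auto
    then show ?thesis
      by (rule tendsto_upperbound[OF _ _ ne]) (use Dg[OF h] in \<open>auto simp: C_def\<close>)
  qed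
  have "(G has_derivative E) (at x)"
    unfolding has_derivative_at
  proof (intro conjI Elin)
    have "((\<lambda>h::'a. C * norm h) \<longlongrightarrow> C * norm (0::'a)) (at 0)"
      by (rule tendsto_mult_left[OF tendsto_norm[OF tendsto_ident_at]])
    then have C0: "((\<lambda>h::'a. C * norm h) \<longlongrightarrow> 0) (at 0)" by simp
    have "\<forall>\<^sub>F h in at (0::'a). norm (norm (G (x + h) - G x - E h) / norm h) \<le> C * norm h"
      unfolding eventually_at
    proof (intro exI[of _ "r/2"] conjI ballI impI)
      fix h :: 'a assume h: "h \<noteq> 0 \<and> dist h 0 < r / 2"
      then have "cmod (G (x + h) - G x - E h) \<le> C * norm h * norm h"
        using main[of h] by (simp add: power2_eq_square mult.assoc)
      then show "norm (norm (G (x + h) - G x - E h) / norm h) \<le> C * norm h"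
        using h by (simp add: divide_le_eq)
    qed (use r in auto)
    then show "((\<lambda>h. norm (G (x + h) - G x - E h) / norm h) \<longlongrightarrow> 0) (at 0)"
      by (rule Lim_null_comparison[OF _ C0])
  qed
  with Ec show "\<exists>D. (G has_derivative D) (at x) \<and> (\<forall>c v. D (c *\<^sub>C v) = c * D v)" by blast
qed

section \<open>Transfer of the cluster value theorem\<close>

lemma ball_algebraI:
  assumes "analytic_on_ball g" "\<And>x. x \<in> ball 0 1 \<Longrightarrow> cmod (g x) \<le> M"
    and "H = Kind_A_u \<Longrightarrow> uniformly_continuous_on (ball 0 1) g"
  shows "ball_restrict g \<in> ball_algebra H"
proof -
  have "ball_restrict g \<in> H_infinity"
    unfolding H_infinity_def
  proof (intro CollectI conjI)
    show "analytic_on_ball (ball_restrict g)"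
      by (rule analytic_on_ball_cong[OF assms(1)]) (simp add: ball_restrict_def)
    show "bounded (ball_restrict g ` ball 0 1)"
      using assms(2) by (intro boundedI[of _ M]) (auto simp: ball_restrict_def)
  qed (auto simp: ball_restrict_def)
  moreover have "uniformly_continuous_on (ball 0 1) (ball_restrict g)" if "H = Kind_A_u"
    using assms(3)[OF that] by (auto simp: uniformly_continuous_on_def ball_restrict_def)
  ultimately show ?thesis by (cases H) (auto simp: A_u_def)
qed

lemma ball_algebra_analytic: "g \<in> ball_algebra H \<Longrightarrow> analytic_on_ball g"
  using ball_algebra_subset_H_infinity by (auto simp: H_infinity_def)

lemma ball_algebra_eq_0: "g \<in> ball_algebra H \<Longrightarrow> x \<notin> ball 0 1 \<Longrightarrow> g x = 0"
  using ball_algebra_subset_H_infinity by (auto simp: H_infinity_def)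

lemma ball_restrict_compose_in_ball_algebra:
  fixes T :: "'a::complex_normed_vector \<Rightarrow> 'b::complex_normed_vector"
  assumes g: "g \<in> ball_algebra H" and T: "clinear_contraction T"
  shows "ball_restrict (\<lambda>x. g (T x)) \<in> ball_algebra H"
proof -
  obtain M where M: "\<And>x. cmod (g x) \<le> M"
    using g ball_algebra_subset_H_infinity H_infinity_bound by blast
  show ?thesis
  proof (rule ball_algebraI)
    show "analytic_on_ball (\<lambda>x. g (T x))"
      by (rule analytic_on_ball_compose[OF ball_algebra_analytic[OF g] T])
    show "uniformly_continuous_on (ball 0 1) (\<lambda>x. g (T x))" if "H = Kind_A_u"
    proof -
      have "uniformly_continuous_on (ball 0 1) g" using g that by (simp add: A_u_def)
      then show ?thesis
        unfolding uniformly_continuous_on_def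
        by (meson T clinear_contraction_ball clinear_contraction_dist order_le_less_trans)
    qed
  qed (rule M)
qed

text \<open>
  For contractions \<open>S n\<close> and compactifying \<open>U\<close> this is the algebra homomorphism through which
  multiplicative functionals are lifted from one ball to the other.
\<close>

definition limit_pullback ::
    "nat filter \<Rightarrow> (nat \<Rightarrow> 'a::complex_normed_vector \<Rightarrow> 'b) \<Rightarrow> ('b \<Rightarrow> complex) \<Rightarrow> 'a \<Rightarrow> complex"
  where "limit_pullback U S g = ball_restrict (\<lambda>x. Lim U (\<lambda>n. g (S n x)))"

lemma limit_pullback_tendsto:
  assumes "compactifying U" "g \<in> ball_algebra H" "x \<in> ball 0 1"
  shows "((\<lambda>n. g (S n x)) \<longlongrightarrow> limit_pullback U S g x) U"
proof -
  obtain M where "\<And>x. cmod (g x) \<le> M"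
    using assms(2) ball_algebra_subset_H_infinity H_infinity_bound by blast
  then have "((\<lambda>n. g (S n x)) \<longlongrightarrow> Lim U (\<lambda>n. g (S n x))) U"
    by (rule compactifying_tendsto_Lim[OF assms(1)])
  with assms(3) show ?thesis by (simp add: limit_pullback_def ball_restrict_def)
qed

lemma limit_pullback_eqI:
  assumes "compactifying U"
    and "\<And>x. x \<in> ball 0 1 \<Longrightarrow> ((\<lambda>n. g (S n x)) \<longlongrightarrow> k x) U"
    and "\<And>x. x \<notin> ball 0 1 \<Longrightarrow> k x = 0"
  shows "limit_pullback U S g = k"
  using assms compactifying_Lim_eqI by (fastforce simp: limit_pullback_def ball_restrict_def)

text \<open>
  The functions \<open>g \<circ> S n\<close> share their sup bound and, because the \<open>S n\<close> are contractions, their modulus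
  of uniform continuity.
\<close>

lemma limit_pullback_in_ball_algebra:
  fixes S :: "nat \<Rightarrow> 'a::complex_normed_vector \<Rightarrow> 'b::complex_normed_vector"
  assumes U: "compactifying U" and g: "g \<in> ball_algebra H"
    and S: "\<And>n. clinear_contraction (S n)"
  shows "limit_pullback U S g \<in> ball_algebra H"
proof -
  have ne: "U \<noteq> bot" using U by (simp add: compactifying_def)
  define G where "G = limit_pullback U S g"
  have G: "((\<lambda>n. g (S n x)) \<longlongrightarrow> G x) U" if "x \<in> ball 0 1" for x
    unfolding G_def by (rule limit_pullback_tendsto[OF U g that])
  obtain M where M: "\<And>x. cmod (g x) \<le> M"
    using g ball_algebra_subset_H_infinity H_infinity_bound by blast
  have "ball_restrict G \<in> ball_algebra H"
  proof (rule ball_algebraI)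
    show "analytic_on_ball G"
    proof (rule analytic_on_ball_limit[OF U _ _ G])
      show "analytic_on_ball (\<lambda>x. g (S n x))" for n
        by (rule analytic_on_ball_compose[OF ball_algebra_analytic[OF g] S])
    qed (rule M)
    show "cmod (G x) \<le> M" if "x \<in> ball 0 1" for x
      by (rule tendsto_upperbound[OF tendsto_norm[OF G[OF that]] _ ne]) (simp add: M)
    show "uniformly_continuous_on (ball 0 1) G" if "H = Kind_A_u"
      unfolding uniformly_continuous_on_def
    proof (intro allI impI)
      fix e :: real assume "e > 0"
      have "uniformly_continuous_on (ball 0 1) g" using g that by (simp add: A_u_def)
      with \<open>e > 0\<close> obtain d where "d > 0"
        and d: "\<And>y z. y \<in> ball 0 1 \<Longrightarrow> z \<in> ball 0 1 \<Longrightarrow> dist z y < d \<Longrightarrow> dist (g z) (g y) < e / 2"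
        unfolding uniformly_continuous_on_def by (metis half_gt_zero)
      have "dist (G z) (G y) < e" if yz: "y \<in> ball 0 1" "z \<in> ball 0 1" "dist z y < d" for y z
      proof -
        have "dist (g (S n z)) (g (S n y)) \<le> e / 2" for n
          using d[of "S n y" "S n z"] yz clinear_contraction_ball[OF S]
            clinear_contraction_dist[OF S, of n z y] by (meson less_imp_le order_le_less_trans)
        then have "dist (G z) (G y) \<le> e / 2"
          by (intro tendsto_upperbound[OF tendsto_dist[OF G[OF yz(2)] G[OF yz(1)]] _ ne]) simp
        then show ?thesis using \<open>e > 0\<close> by simp
      qed
      with \<open>d > 0\<close> show "\<exists>d>0. \<forall>x\<in>ball 0 1. \<forall>x'\<in>ball 0 1. dist x' x < d \<longrightarrow> dist (G x') (G x) < e"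
        by blast
    qed
  qed
  moreover have "ball_restrict G = G"
    by (auto simp: G_def limit_pullback_def ball_restrict_def)
  ultimately show ?thesis by (simp add: G_def)
qed

text \<open>
  The homomorphism \<open>limit_pullback\<close> restricted to functionals; its adjoint transports points of one
  bidual to the other.
\<close>

definition dual_limit ::
    "nat filter \<Rightarrow> (nat \<Rightarrow> 'a::complex_normed_vector \<Rightarrow> 'b::complex_normed_vector) \<Rightarrow> 'b cdual \<Rightarrow> 'a cdual"
  where "dual_limit U S g = cdual_of (\<lambda>x. Lim U (\<lambda>n. cdual_apply g (S n x)))"

context
  fixes U :: "nat filter"
    and S :: "nat \<Rightarrow> 'a::complex_normed_vector \<Rightarrow> 'b::complex_normed_vector"
  assumes U: "compactifying U" and S: "\<And>n. clinear_contraction (S n)"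
begin

lemma cdual_apply_section_le: "cmod (cdual_apply g (S n x)) \<le> norm g * norm x"
  using norm_cdual_apply_le[of g "S n x"] clinear_contractionD(3)[OF S, of n x]
  by (meson mult_left_mono norm_ge_zero order_trans)

lemma section_tendsto_Lim:
  "((\<lambda>n. cdual_apply g (S n x)) \<longlongrightarrow> Lim U (\<lambda>n. cdual_apply g (S n x))) U"
  by (rule compactifying_tendsto_Lim[OF U cdual_apply_section_le])

lemma shows dual_limit_tendsto:
    "((\<lambda>n. cdual_apply g (S n x)) \<longlongrightarrow> cdual_apply (dual_limit U S g) x) U"
  and norm_dual_limit_le: "norm (dual_limit U S g) \<le> norm g"
proof -
  have ne: "U \<noteq> bot" using U by (simp add: compactifying_def)
  define L where "L = (\<lambda>x. Lim U (\<lambda>n. cdual_apply g (S n x)))"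
  have L: "((\<lambda>n. cdual_apply g (S n x)) \<longlongrightarrow> L x) U" for x
    unfolding L_def by (rule section_tendsto_Lim)
  have add: "L (x + y) = L x + L y" for x y
    using tendsto_add[OF L[of x] L[of y]] tendsto_unique[OF ne L[of "x + y"]]
    by (simp add: clinear_contractionD[OF S] cdual_apply_add_right)
  have scale: "L (c *\<^sub>C x) = c * L x" for c x
    using tendsto_mult_left[OF L[of x], of c] tendsto_unique[OF ne L[of "c *\<^sub>C x"]]
    by (simp add: clinear_contractionD[OF S] cdual_apply_scaleC_right)
  have bound: "cmod (L x) \<le> norm g * norm x" for x
    by (rule tendsto_upperbound[OF tendsto_norm[OF L] _ ne]) (simp add: cdual_apply_section_le)
  note of = cdual_of[of L, OF add scale bound norm_ge_zero]
  show "((\<lambda>n. cdual_apply g (S n x)) \<longlongrightarrow> cdual_apply (dual_limit U S g) x) U"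
    using L of(1) by (simp add: dual_limit_def L_def)
  show "norm (dual_limit U S g) \<le> norm g" using of(2) by (simp add: dual_limit_def L_def)
qed

lemma cdual_apply_dual_limit_eqI:
  "((\<lambda>n. cdual_apply g (S n x)) \<longlongrightarrow> l) U \<Longrightarrow> cdual_apply (dual_limit U S g) x = l"
  using dual_limit_tendsto U tendsto_unique unfolding compactifying_def by blast

lemma dual_limit_add: "dual_limit U S (g + h) = dual_limit U S g + dual_limit U S h"
  by (intro cdual_eqI cdual_apply_dual_limit_eqI)
    (simp add: cdual_apply_add_left tendsto_add dual_limit_tendsto)

lemma dual_limit_scaleC: "dual_limit U S (c *\<^sub>C g) = c *\<^sub>C dual_limit U S g"
  by (intro cdual_eqI cdual_apply_dual_limit_eqI)
    (simp add: cdual_apply_scaleC_left tendsto_mult_left dual_limit_tendsto)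

lemma limit_pullback_ball_restrict_cdual:
  "limit_pullback U S (ball_restrict (cdual_apply g))
    = ball_restrict (cdual_apply (dual_limit U S g))"
  by (rule limit_pullback_eqI[OF U])
    (auto simp: ball_restrict_def dual_limit_tendsto clinear_contraction_ball[OF S, simplified])

text \<open>
  Composition with the homomorphism preserves sums, scalars and products; surjectivity is what keeps
  the composite nonzero.
\<close>

lemma fiber_limit_pullback:
  assumes \<tau>: "\<tau> \<in> fiber (ball_algebra H) \<phi>"
    and onto: "\<And>h. h \<in> ball_algebra H \<Longrightarrow> \<exists>g \<in> ball_algebra H. limit_pullback U S g = h"
  shows "(\<lambda>g. \<tau> (limit_pullback U S g))
    \<in> fiber (ball_algebra H) (cdual_of (\<lambda>g. cdual_apply \<phi> (dual_limit U S g)))"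
    (is "?\<tau> \<in> fiber _ ?\<psi>")
    and "norm (cdual_of (\<lambda>g. cdual_apply \<phi> (dual_limit U S g))) \<le> norm \<phi>"
proof -
  have \<psi>: "cdual_apply ?\<psi> = (\<lambda>g. cdual_apply \<phi> (dual_limit U S g))" "norm ?\<psi> \<le> norm \<phi>"
  proof -
    have *: "cmod (cdual_apply \<phi> (dual_limit U S g)) \<le> norm \<phi> * norm g" for g
      using norm_cdual_apply_le[of \<phi> "dual_limit U S g"] norm_dual_limit_le[of g]
      by (meson mult_left_mono norm_ge_zero order_trans)
    note of = cdual_of[of "\<lambda>g. cdual_apply \<phi> (dual_limit U S g)", OF _ _ * norm_ge_zero]
    show "cdual_apply ?\<psi> = (\<lambda>g. cdual_apply \<phi> (dual_limit U S g))" "norm ?\<psi> \<le> norm \<phi>"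
      by (rule of; simp add: dual_limit_add dual_limit_scaleC cdual_apply_add_right
          cdual_apply_scaleC_right)+
  qed
  then show "norm ?\<psi> \<le> norm \<phi>" by simp
  let ?A = "ball_algebra H :: ('a \<Rightarrow> complex) set"
  let ?B = "ball_algebra H :: ('b \<Rightarrow> complex) set"
  let ?T = "limit_pullback U S"
  have mf: "multiplicative_functional ?A \<tau>"
    and val: "\<And>g. \<tau> (ball_restrict (cdual_apply g)) = cdual_apply \<phi> g"
    using \<tau> by (auto simp: fiber_def)
  have T: "?T g \<in> ?A" if "g \<in> ?B" for g
    by (rule limit_pullback_in_ball_algebra[OF U that S])
  note lim = limit_pullback_tendsto[OF U]
  have zero: "?T g x = 0" if "x \<notin> ball 0 1" for g x
    using that by (simp add: limit_pullback_def ball_restrict_def)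
  have T_add: "?T (\<lambda>y. f y + g y) = (\<lambda>x. ?T f x + ?T g x)" if "f \<in> ?B" "g \<in> ?B" for f g
    using that by (intro limit_pullback_eqI[OF U] tendsto_add lim) (auto simp: zero)
  have T_mult: "?T (\<lambda>y. f y * g y) = (\<lambda>x. ?T f x * ?T g x)" if "f \<in> ?B" "g \<in> ?B" for f g
    using that by (intro limit_pullback_eqI[OF U] tendsto_mult lim) (auto simp: zero)
  have T_scale: "?T (\<lambda>y. c * f y) = (\<lambda>x. c * ?T f x)" if "f \<in> ?B" for f c
    using that by (intro limit_pullback_eqI[OF U] tendsto_mult_left lim) (auto simp: zero)
  have "multiplicative_functional ?B ?\<tau>"
    unfolding multiplicative_functional_def
  proof (intro conjI ballI allI)
    show "\<exists>g\<in>?B. ?\<tau> g \<noteq> 0"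
      using mf onto unfolding multiplicative_functional_def by metis
  qed (use mf T in \<open>auto simp: multiplicative_functional_def T_add T_mult T_scale\<close>)
  then show "?\<tau> \<in> fiber (ball_algebra H) ?\<psi>"
    unfolding fiber_def by (simp add: limit_pullback_ball_restrict_cdual val \<psi>)
qed

end

text \<open>
  Here \<open>k \<mapsto> k \<circ> Q\<close> is a right inverse of \<open>limit_pullback U S\<close>, on the algebras as well as on the duals.
  On the algebras this makes \<open>\<tau> h\<close> a value of the lifted functional; on the duals it makes \<open>Q\<close> send
  nets converging to \<open>\<psi>\<close> to nets converging to \<open>\<phi>\<close>.
\<close>

theorem cluster_value_theorem_transfer:
  fixes Q :: "'b::complex_normed_vector \<Rightarrow> 'a::complex_normed_vector"
  assumes Q: "clinear_contraction Q" and S: "\<And>n. clinear_contraction (S n)"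
    and QS: "\<And>x. (\<lambda>n. Q (S n x)) \<longlonglongrightarrow> x"
    and cvt: "satisfies_cluster_value_theorem TYPE('b) H"
  shows "satisfies_cluster_value_theorem TYPE('a) H"
  unfolding satisfies_cluster_value_theorem_def cluster_value_theorem_at_def
proof (intro allI impI ballI subsetI)
  fix \<phi> :: "'a cdual cdual" and h z
  assume \<phi>: "norm \<phi> \<le> 1" and h: "h \<in> ball_algebra H"
    and "z \<in> {\<tau> h | \<tau>. \<tau> \<in> fiber (ball_algebra H) \<phi>}"
  then obtain \<tau> where \<tau>: "\<tau> \<in> fiber (ball_algebra H) \<phi>" and z: "z = \<tau> h" by blast
  obtain U where U: "compactifying U" using ex_compactifying by blast
  have U_le: "U \<le> sequentially" using U by (simp add: compactifying_def)
  define lift where "lift = (\<lambda>k :: 'a \<Rightarrow> complex. ball_restrict (\<lambda>y. k (Q y)))"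
  have lift: "lift k \<in> ball_algebra H" if "k \<in> ball_algebra H" for k
    unfolding lift_def by (rule ball_restrict_compose_in_ball_algebra[OF that Q])
  have T_lift: "limit_pullback U S (lift k) = k" if k: "k \<in> ball_algebra H" for k
  proof (rule limit_pullback_eqI[OF U])
    fix x :: 'a assume x: "x \<in> ball 0 1"
    obtain D where "(k has_derivative D) (at x)"
      using ball_algebra_analytic[OF k] x unfolding analytic_on_ball_def by blast
    then have "isCont k x" by (rule has_derivative_continuous)
    then have "((\<lambda>n. k (Q (S n x))) \<longlongrightarrow> k x) U"
      by (rule isCont_tendsto_compose) (rule tendsto_mono[OF U_le QS])
    moreover have "lift k (S n x) = k (Q (S n x))" for n
      using clinear_contraction_ball[OF S x] by (simp add: lift_def ball_restrict_def)
    ultimately show "((\<lambda>n. lift k (S n x)) \<longlongrightarrow> k x) U" by simp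
  qed (rule ball_algebra_eq_0[OF k])
  define \<psi> where "\<psi> = cdual_of (\<lambda>g. cdual_apply \<phi> (dual_limit U S g))"
  have fib: "(\<lambda>g. \<tau> (limit_pullback U S g)) \<in> fiber (ball_algebra H) \<psi>" and "norm \<psi> \<le> norm \<phi>"
    unfolding \<psi>_def using fiber_limit_pullback[where S = S, OF U S \<tau>] lift T_lift by blast+
  from this(2) \<phi> have "cluster_value_theorem_at (ball_algebra H) \<psi>"
    using cvt unfolding satisfies_cluster_value_theorem_def by simp
  with fib lift[OF h] have "\<tau> (limit_pullback U S (lift h)) \<in> cluster_set (lift h) \<psi>"
    unfolding cluster_value_theorem_at_def by blast
  then have "z \<in> cluster_set (lift h) \<psi>" by (simp add: z T_lift h)
  then obtain F where F: "F \<noteq> bot" "\<forall>\<^sub>F y in F. y \<in> ball 0 1"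
      "\<And>g. ((\<lambda>y. cdual_apply g y) \<longlongrightarrow> cdual_apply \<psi> g) F" "(lift h \<longlongrightarrow> z) F"
    unfolding cluster_set_def by blast
  show "z \<in> cluster_set h \<phi>"
    unfolding cluster_set_def
  proof (intro CollectI exI[of _ "filtermap Q F"] conjI allI)
    show "filtermap Q F \<noteq> bot" using F(1) by (simp add: filtermap_bot_iff)
    show "\<forall>\<^sub>F x in filtermap Q F. x \<in> ball 0 1"
      unfolding eventually_filtermap using F(2)
      by eventually_elim (rule clinear_contraction_ball[OF Q])
    show "(h \<longlongrightarrow> z) (filtermap Q F)"
      unfolding filterlim_filtermap
      by (rule Lim_transform_eventually[OF F(4)])
        (use F(2) in eventually_elim, simp add: lift_def ball_restrict_def)
    fix g :: "'a cdual"
    define gQ where "gQ = cdual_of (\<lambda>y. cdual_apply g (Q y))"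
    have "cmod (cdual_apply g (Q y)) \<le> norm g * norm y" for y
      using norm_cdual_apply_le[of g "Q y"] clinear_contractionD(3)[OF Q, of y]
      by (meson mult_left_mono norm_ge_zero order_trans)
    then have gQ: "cdual_apply gQ = (\<lambda>y. cdual_apply g (Q y))"
      unfolding gQ_def
      by (intro cdual_apply_cdual_of[where K = "norm g"])
        (simp_all add: clinear_contractionD[OF Q] cdual_apply_add_right cdual_apply_scaleC_right)
    have "dual_limit U S gQ = g"
    proof (intro cdual_eqI cdual_apply_dual_limit_eqI[OF U S])
      fix x
      have "isCont (cdual_apply g) (x :: 'a)"
        unfolding cdual_apply_def by (intro linear_continuous_at blinfun.bounded_linear_right)
      then show "((\<lambda>n. cdual_apply gQ (S n x)) \<longlongrightarrow> cdual_apply g x) U"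
        unfolding gQ by (rule isCont_tendsto_compose) (rule tendsto_mono[OF U_le QS])
    qed
    moreover have "cdual_apply \<psi> gQ = cdual_apply \<phi> (dual_limit U S gQ)"
    proof -
      have "\<tau> (limit_pullback U S (ball_restrict (cdual_apply gQ))) = cdual_apply \<psi> gQ"
        using fib by (simp add: fiber_def)
      moreover have "\<tau> (ball_restrict (cdual_apply (dual_limit U S gQ)))
          = cdual_apply \<phi> (dual_limit U S gQ)"
        using \<tau> by (simp add: fiber_def)
      ultimately show ?thesis by (simp add: limit_pullback_ball_restrict_cdual[OF U S])
    qed
    ultimately show "((\<lambda>x. cdual_apply g x) \<longlongrightarrow> cdual_apply \<phi> g) (filtermap Q F)"
      unfolding filterlim_filtermap using F(3)[of gQ] by (simp add: gQ)
  qed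
qed

section \<open>Averaging over equal subintervals of the unit interval\<close>

text \<open>
  By monotone convergence the sum of the norms has a finite integral and so is finite almost
  everywhere. For \<open>synthesis\<close> this turns a series in \<open>L1\<close> into a pointwise one.
\<close>

lemma AE_summable_norm:
  fixes f :: "nat \<Rightarrow> 'a \<Rightarrow> complex"
  assumes f: "\<And>i. integrable M (f i)" and sums: "summable (\<lambda>i. \<integral>t. cmod (f i t) \<partial>M)"
  shows "AE t in M. summable (\<lambda>i. cmod (f i t))"
proof -
  have [measurable]: "f i \<in> borel_measurable M" for i using f by auto
  have "(\<integral>\<^sup>+t. (\<Sum>i. ennreal (cmod (f i t))) \<partial>M) = (\<Sum>i. \<integral>\<^sup>+t. ennreal (cmod (f i t)) \<partial>M)"
    by (intro nn_integral_suminf) auto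
  also have "\<dots> = (\<Sum>i. ennreal (\<integral>t. cmod (f i t) \<partial>M))"
    by (intro arg_cong[where f = suminf] ext nn_integral_eq_integral integrable_norm f) auto
  also have "\<dots> \<noteq> \<infinity>" using sums by (simp add: ennreal_suminf_neq_top)
  finally have "AE t in M. (\<Sum>i. ennreal (cmod (f i t))) \<noteq> \<infinity>"
    by (intro nn_integral_PInf_AE) auto
  then show ?thesis
    by eventually_elim (auto intro: summable_suminf_not_top)
qed

text \<open>
  The cells with \<open>k \<le> n\<close> partition the open unit interval, and all others are empty. Intersecting with
  the open interval drops the point 0 from the first cell.
\<close>

definition cell :: "nat \<Rightarrow> nat \<Rightarrow> real set"
  where "cell n k = {t \<in> {0<..<1}. \<lfloor>real (Suc n) * t\<rfloor> = int k}"

lemma cell_iff: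
  "t \<in> cell n k \<longleftrightarrow> 0 < t \<and> t < 1 \<and>
    real k / real (Suc n) \<le> t \<and> t < real (Suc k) / real (Suc n)"
  by (auto simp: cell_def floor_eq_iff field_simps)

lemma cell_subset: "cell n k \<subseteq> {real k / real (Suc n) .. real (Suc k) / real (Suc n)}"
  by (auto simp only: cell_iff subset_iff atLeastAtMost_iff less_imp_le)

lemma cell_in_sets: "cell n k \<in> sets unit_interval"
proof -
  have "cell n k = {0<..<1} \<inter> {real k / real (Suc n) ..< real (Suc k) / real (Suc n)}"
    by (auto simp only: cell_iff Int_iff greaterThanLessThan_iff atLeastLessThan_iff)
  then show ?thesis by (simp add: sets_restrict_space_iff)
qed

lemma cell_lmeasurable: "cell n k \<in> lmeasurable"
proof (rule bounded_set_imp_lmeasurable)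
  show "bounded (cell n k)" by (rule bounded_subset[of "{0<..<1}"]) (auto simp: cell_def)
  show "cell n k \<in> sets lebesgue" using cell_in_sets[of n k] by (simp add: sets_restrict_space_iff)
qed

lemma measure_cell: "measure unit_interval (cell n k) = measure lebesgue (cell n k)"
  by (rule measure_restrict_space) (auto simp: cell_def)

lemma measure_cell_le: "measure unit_interval (cell n k) \<le> 1 / real (Suc n)"
proof -
  have "measure lebesgue (cell n k)
      \<le> measure lebesgue {real k / real (Suc n) .. real (Suc k) / real (Suc n)}"
    by (intro measure_mono_fmeasurable cell_subset fmeasurableD cell_lmeasurable) simp
  then show ?thesis by (simp add: measure_cell divide_right_mono flip: diff_divide_distrib)
qed

lemma measure_cell_eq:
  assumes "k \<le> n" shows "measure unit_interval (cell n k) = 1 / real (Suc n)"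
proof (rule antisym[OF measure_cell_le])
  have "0 \<le> real k / real (Suc n)" "real (Suc k) / real (Suc n) \<le> 1"
    using assms by simp_all
  then have "{real k / real (Suc n) <..< real (Suc k) / real (Suc n)} \<subseteq> cell n k"
    unfolding subset_iff greaterThanLessThan_iff cell_iff by linarith
  then have "measure lebesgue {real k / real (Suc n) <..< real (Suc k) / real (Suc n)}
      \<le> measure lebesgue (cell n k)"
    by (intro measure_mono_fmeasurable cell_lmeasurable) auto
  then show "1 / real (Suc n) \<le> measure unit_interval (cell n k)"
    by (simp add: measure_cell divide_right_mono flip: diff_divide_distrib)
qed

lemma ex1_cell:
  assumes "t \<in> {0<..<1}" obtains k where "k \<le> n" "\<And>j. t \<in> cell n j \<longleftrightarrow> j = k"
proof
  have pos: "0 \<le> \<lfloor>real (Suc n) * t\<rfloor>" using assms by simp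
  have "real (Suc n) * t < real (Suc n)" using assms by simp
  then have "\<lfloor>real (Suc n) * t\<rfloor> < int (Suc n)" by (simp add: floor_less_iff)
  then show "nat \<lfloor>real (Suc n) * t\<rfloor> \<le> n" using pos by linarith
  show "t \<in> cell n j \<longleftrightarrow> j = nat \<lfloor>real (Suc n) * t\<rfloor>" for j
    using assms pos by (auto simp: cell_def)
qed

lemma sum_indicator_cell:
  fixes F :: "nat \<Rightarrow> 'a::real_vector"
  assumes "k \<le> n" "\<And>j. t \<in> cell n j \<longleftrightarrow> j = k"
  shows "(\<Sum>j\<le>n. indicator (cell n j) t *\<^sub>R F j) = F k"
proof -
  have "(\<Sum>j\<le>n. indicator (cell n j) t *\<^sub>R F j) = (\<Sum>j\<le>n. if j = k then F j else 0)"
    by (rule sum.cong) (auto simp: assms(2) indicator_def)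
  with assms(1) show ?thesis by simp
qed

text \<open>
  The image of the \<open>i\<close>-th unit vector under \<open>synthesis\<close>. All partitions are used at once:
  \<open>prod_decode\<close> splits the index into the number of the partition and that of the cell.
\<close>

definition bump :: "nat \<Rightarrow> real \<Rightarrow> complex"
  where "bump i t = (case prod_decode i of (n, k) \<Rightarrow> of_nat (Suc n) * indicator (cell n k) t)"

lemma integrable_bump: "integrable unit_interval (bump i)"
  and norm_bump_le: "(\<integral>t. cmod (bump i t) \<partial>unit_interval) \<le> 1"
proof -
  obtain n k where i: "prod_decode i = (n, k)" by fastforce
  have emeasure: "emeasure unit_interval (cell n k) < \<infinity>"
    using cell_lmeasurable[of n k]
    by (subst emeasure_restrict_space) (auto simp: cell_def fmeasurable_def)
  have bump: "bump i = (\<lambda>t. of_nat (Suc n) * of_real (indicator (cell n k) t))"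
    by (auto simp: bump_def i indicator_def fun_eq_iff)
  have int: "integrable unit_interval (indicator (cell n k) :: real \<Rightarrow> real)"
    using emeasure cell_in_sets by (intro integrable_real_indicator) auto
  then show "integrable unit_interval (bump i)" unfolding bump
    by (intro integrable_mult_right integrable_of_real) auto
  have "cmod (bump i t) = real (Suc n) * indicator (cell n k) t" for t
    unfolding bump norm_mult norm_of_nat by (simp add: indicator_def)
  moreover have "(\<integral>t. real (Suc n) * indicator (cell n k) t \<partial>unit_interval)
      = real (Suc n) * measure unit_interval (cell n k)"
  proof -
    have "cell n k \<inter> {0<..<1} = cell n k" by (auto simp: cell_def)
    then show ?thesis by simp
  qed
  ultimately show "(\<integral>t. cmod (bump i t) \<partial>unit_interval) \<le> 1"
    using mult_left_mono[OF measure_cell_le[of n k], of "real (Suc n)"] by simp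
qed

lemma
  assumes y: "summable (\<lambda>i. cmod (y i))"
  shows AE_summable_synthesis: "AE t in unit_interval. summable (\<lambda>i. cmod (y i * bump i t))"
    and integrable_synthesis: "integrable unit_interval (\<lambda>t. \<Sum>i. y i * bump i t)"
    and norm_synthesis_le:
      "(\<integral>t. cmod (\<Sum>i. y i * bump i t) \<partial>unit_interval) \<le> (\<Sum>i. cmod (y i))"
proof -
  have int: "integrable unit_interval (\<lambda>t. y i * bump i t)" for i
    by (intro integrable_mult_right integrable_bump)
  have le: "(\<integral>t. cmod (y i * bump i t) \<partial>unit_interval) \<le> cmod (y i)" for i
    using mult_left_mono[OF norm_bump_le[of i], of "cmod (y i)"] by (simp add: norm_mult)
  have sums: "summable (\<lambda>i. \<integral>t. cmod (y i * bump i t) \<partial>unit_interval)"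
    by (rule summable_comparison_test'[OF y, where N = 0]) (use le in simp)
  show AE: "AE t in unit_interval. summable (\<lambda>i. cmod (y i * bump i t))"
    by (rule AE_summable_norm[OF int sums])
  show I: "integrable unit_interval (\<lambda>t. \<Sum>i. y i * bump i t)"
    by (rule integrable_suminf[OF int AE sums])
  have AE': "AE t in unit_interval. summable (\<lambda>i. norm (cmod (y i * bump i t)))"
    using AE by simp
  have sums': "summable (\<lambda>i. \<integral>t. norm (cmod (y i * bump i t)) \<partial>unit_interval)"
    using sums by simp
  note norm_int = integrable_norm[OF int]
  have "(\<integral>t. cmod (\<Sum>i. y i * bump i t) \<partial>unit_interval)
      \<le> (\<integral>t. (\<Sum>i. cmod (y i * bump i t)) \<partial>unit_interval)"
  proof (rule integral_mono_AE)
    show "integrable unit_interval (\<lambda>t. \<Sum>i. cmod (y i * bump i t))"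
      by (rule integrable_suminf[OF norm_int AE' sums'])
    show "AE t in unit_interval. cmod (\<Sum>i. y i * bump i t) \<le> (\<Sum>i. cmod (y i * bump i t))"
      using AE by eventually_elim (rule summable_norm)
  qed (use I in auto)
  also have "\<dots> = (\<Sum>i. \<integral>t. cmod (y i * bump i t) \<partial>unit_interval)"
    by (rule integral_suminf[OF norm_int AE' sums'])
  also have "\<dots> \<le> (\<Sum>i. cmod (y i))"
    by (rule suminf_le[OF le sums y])
  finally show "(\<integral>t. cmod (\<Sum>i. y i * bump i t) \<partial>unit_interval) \<le> (\<Sum>i. cmod (y i))" .
qed

lift_definition synthesis :: "ell1 \<Rightarrow> L1" is "\<lambda>y t. \<Sum>i. y i * bump i t"
  by (simp add: integrable_synthesis)

lemma clinear_contraction_synthesis: "clinear_contraction synthesis"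
  unfolding clinear_contraction_def
proof (intro conjI allI)
  show "synthesis (x + y) = synthesis x + synthesis y" for x y
  proof transfer
    fix x y :: "nat \<Rightarrow> complex"
    assume s: "summable (\<lambda>n. cmod (x n))" "summable (\<lambda>n. cmod (y n))"
    have "summable (\<lambda>n. cmod (x n + y n))"
      by (rule summable_comparison_test'[OF summable_add[OF s]]) (auto intro: norm_triangle_ineq)
    moreover have "AE t in unit_interval. (\<Sum>i. (x i + y i) * bump i t)
        = (\<Sum>i. x i * bump i t) + (\<Sum>i. y i * bump i t)"
      using AE_summable_synthesis[OF s(1)] AE_summable_synthesis[OF s(2)]
      by eventually_elim (simp add: suminf_add summable_norm_cancel distrib_right)
    ultimately show "integrable unit_interval (\<lambda>t. \<Sum>i. (x i + y i) * bump i t) \<and>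
        integrable unit_interval (\<lambda>t. (\<Sum>i. x i * bump i t) + (\<Sum>i. y i * bump i t)) \<and>
        (AE t in unit_interval. (\<Sum>i. (x i + y i) * bump i t)
          = (\<Sum>i. x i * bump i t) + (\<Sum>i. y i * bump i t))"
      using integrable_synthesis s by auto
  qed
  show "synthesis (c *\<^sub>C y) = c *\<^sub>C synthesis y" for c y
  proof transfer
    fix c and y :: "nat \<Rightarrow> complex"
    assume s: "summable (\<lambda>n. cmod (y n))"
    have "summable (\<lambda>n. cmod (c * y n))" using s by (simp add: norm_mult summable_mult)
    moreover have "AE t in unit_interval. (\<Sum>i. c * y i * bump i t) = c * (\<Sum>i. y i * bump i t)"
      using AE_summable_synthesis[OF s]
      by eventually_elim (simp add: suminf_mult summable_norm_cancel mult.assoc)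
    ultimately show "integrable unit_interval (\<lambda>t. \<Sum>i. c * y i * bump i t) \<and>
        integrable unit_interval (\<lambda>t. c * (\<Sum>i. y i * bump i t)) \<and>
        (AE t in unit_interval. (\<Sum>i. c * y i * bump i t) = c * (\<Sum>i. y i * bump i t))"
      using integrable_synthesis s by auto
  qed
  show "norm (synthesis y) \<le> norm y" for y
    by transfer (rule norm_synthesis_le)
qed

text \<open>
  The finite family \<open>F 0, \<dots>, F n\<close> placed in the \<open>n\<close>-th block of a sequence, with zeros elsewhere.
\<close>

definition level :: "nat \<Rightarrow> (nat \<Rightarrow> 'a::zero) \<Rightarrow> nat \<Rightarrow> 'a"
  where "level n F i = (case prod_decode i of (m, k) \<Rightarrow> if m = n \<and> k \<le> n then F k else 0)"

lemma level_sums: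
  fixes F :: "nat \<Rightarrow> 'a::{t2_space, comm_monoid_add}"
  shows "level n F sums (\<Sum>k\<le>n. F k)"
proof -
  have "level n F sums sum (level n F) ((\<lambda>k. prod_encode (n, k)) ` {..n})"
  proof (rule sums_finite)
    fix i assume i: "i \<notin> (\<lambda>k. prod_encode (n, k)) ` {..n}"
    obtain m k where mk: "prod_decode i = (m, k)" by fastforce
    then have "i = prod_encode (m, k)" by (metis prod_decode_inverse)
    with i show "level n F i = 0" by (auto simp: mk level_def)
  qed simp
  also have "sum (level n F) ((\<lambda>k. prod_encode (n, k)) ` {..n}) = (\<Sum>k\<le>n. F k)"
    by (subst sum.reindex) (auto simp: inj_on_def prod_encode_eq level_def)
  finally show ?thesis .
qed

lemma norm_level: "norm (level n F i) = level n (\<lambda>k. norm (F k)) i"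
  by (simp add: level_def split: prod.split)

lemma summable_norm_level: "summable (\<lambda>i. norm (level n F i))"
  unfolding norm_level by (rule sums_summable[OF level_sums])

abbreviation cell_integral :: "nat \<Rightarrow> nat \<Rightarrow> (real \<Rightarrow> complex) \<Rightarrow> complex"
  where "cell_integral n k f \<equiv> (\<integral>t. indicator (cell n k) t *\<^sub>R f t \<partial>unit_interval)"

lemma integrable_cell:
  fixes f :: "real \<Rightarrow> 'a::{banach, second_countable_topology}"
  assumes "integrable unit_interval f"
  shows "integrable unit_interval (\<lambda>t. indicator (cell n k) t *\<^sub>R f t)"
  by (rule integrable_mult_indicator[OF cell_in_sets assms])

text \<open>
  The reason why \<open>analysis\<close> is a contraction: the cells are disjoint.
\<close>

lemma sum_cell_integral_le:
  assumes f: "integrable unit_interval f"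
  shows "(\<Sum>k\<le>n. cmod (cell_integral n k f)) \<le> (\<integral>t. cmod (f t) \<partial>unit_interval)"
proof -
  have nf: "integrable unit_interval (\<lambda>t. cmod (f t))" using f by simp
  have "(\<Sum>k\<le>n. cmod (cell_integral n k f))
      \<le> (\<Sum>k\<le>n. \<integral>t. indicator (cell n k) t *\<^sub>R cmod (f t) \<partial>unit_interval)"
  proof (rule sum_mono)
    fix k
    have "cmod (cell_integral n k f) \<le> (\<integral>t. cmod (indicator (cell n k) t *\<^sub>R f t) \<partial>unit_interval)"
      by (rule integral_norm_bound)
    then show "cmod (cell_integral n k f)
        \<le> (\<integral>t. indicator (cell n k) t *\<^sub>R cmod (f t) \<partial>unit_interval)"
      by simp
  qed
  also have "\<dots> = (\<integral>t. (\<Sum>k\<le>n. indicator (cell n k) t *\<^sub>R cmod (f t)) \<partial>unit_interval)"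
    using integrable_cell[OF nf] by (intro Bochner_Integration.integral_sum[symmetric]) auto
  also have "\<dots> = (\<integral>t. cmod (f t) \<partial>unit_interval)"
  proof (rule Bochner_Integration.integral_cong[OF refl])
    fix t assume "t \<in> space unit_interval"
    then have "t \<in> {0<..<1}" by simp
    then obtain k where "k \<le> n" "\<And>j. t \<in> cell n j \<longleftrightarrow> j = k" using ex1_cell by blast
    then show "(\<Sum>k\<le>n. indicator (cell n k) t *\<^sub>R cmod (f t)) = cmod (f t)"
      using sum_indicator_cell[of k n t "\<lambda>_. cmod (f t)"] by blast
  qed
  finally show ?thesis .
qed

lemma cell_integral_cong_AE:
  assumes "integrable unit_interval f" "integrable unit_interval g"
    and "AE t in unit_interval. f t = g t"
  shows "cell_integral n k f = cell_integral n k g"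
proof (rule integral_cong_AE)
  show "AE t in unit_interval. indicator (cell n k) t *\<^sub>R f t = indicator (cell n k) t *\<^sub>R g t"
    using assms(3) by eventually_elim simp
qed (intro borel_measurable_integrable integrable_cell assms)+

lift_definition analysis :: "nat \<Rightarrow> L1 \<Rightarrow> ell1"
  is "\<lambda>n f. level n (\<lambda>k. cell_integral n k f)"
  by (auto simp: summable_norm_level intro!: arg_cong[where f = "level _"] cell_integral_cong_AE)

lemma clinear_contraction_analysis: "clinear_contraction (analysis n)"
  unfolding clinear_contraction_def
proof (intro conjI allI)
  show "analysis n (x + y) = analysis n x + analysis n y" for x y
  proof transfer
    fix n and f g :: "real \<Rightarrow> complex"
    assume "integrable unit_interval f \<and> integrable unit_interval f \<and>
        (AE t in unit_interval. f t = f t)"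
      and "integrable unit_interval g \<and> integrable unit_interval g \<and>
        (AE t in unit_interval. g t = g t)"
    then have "cell_integral n k (\<lambda>t. f t + g t) = cell_integral n k f + cell_integral n k g" for k
      using integrable_cell[of f n k] integrable_cell[of g n k] by (simp add: scaleR_add_right)
    then show "level n (\<lambda>k. cell_integral n k (\<lambda>t. f t + g t))
        = (\<lambda>i. level n (\<lambda>k. cell_integral n k f) i + level n (\<lambda>k. cell_integral n k g) i)"
      by (simp add: level_def fun_eq_iff split: prod.split)
  qed
  show "analysis n (c *\<^sub>C x) = c *\<^sub>C analysis n x" for c x
  proof transfer
    fix n c and f :: "real \<Rightarrow> complex"
    have "cell_integral n k (\<lambda>t. c * f t) = c * cell_integral n k f" for k
      by (simp only: flip: mult_scaleR_right integral_mult_right_zero)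
    then show "level n (\<lambda>k. cell_integral n k (\<lambda>t. c * f t))
        = (\<lambda>i. c * level n (\<lambda>k. cell_integral n k f) i)"
      by (simp add: level_def fun_eq_iff split: prod.split)
  qed
  show "norm (analysis n x) \<le> norm x" for x
    by transfer (simp add: norm_level sums_unique[OF level_sums, symmetric] sum_cell_integral_le)
qed

definition cell_average :: "nat \<Rightarrow> (real \<Rightarrow> complex) \<Rightarrow> real \<Rightarrow> complex"
  where "cell_average n f t = (\<Sum>k\<le>n. indicator (cell n k) t *\<^sub>R (of_nat (Suc n) * cell_integral n k f))"

lemma synthesis_level:
  "(\<Sum>i. level n (\<lambda>k. cell_integral n k f) i * bump i t) = cell_average n f t"
proof -
  have "(\<lambda>i. level n (\<lambda>k. cell_integral n k f) i * bump i t)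
    = level n (\<lambda>k. indicator (cell n k) t *\<^sub>R (of_nat (Suc n) * cell_integral n k f))"
    by (auto simp: level_def bump_def fun_eq_iff indicator_def split: prod.split)
  then show ?thesis
    unfolding cell_average_def by (simp only: sums_unique[OF level_sums])
qed

section \<open>Convergence of the averages\<close>

lemma measure_unit_interval: "measure unit_interval {0<..<1} = 1"
  by (subst measure_restrict_space) auto

lemma finite_measure_unit_interval: "finite_measure unit_interval"
  by (rule finite_measureI) (simp add: emeasure_restrict_space)

lemma integrable_unit_interval_const: "integrable unit_interval (\<lambda>_. c :: 'a::{banach, second_countable_topology})"
  by (rule finite_measure.integrable_const[OF finite_measure_unit_interval])

text \<open>
  The average of \<open>f\<close> over the cell of \<open>t\<close> differs from \<open>f t\<close> by the average of \<open>f - f t\<close>, and a cell has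
  diameter at most \<open>1 / (n + 1)\<close>.
\<close>

lemma cell_average_dist_le:
  assumes f: "integrable unit_interval f" and t: "t \<in> {0<..<1}"
    and osc: "\<And>s. s \<in> {0<..<1} \<Longrightarrow> \<bar>s - t\<bar> \<le> 1 / real (Suc n) \<Longrightarrow> cmod (f s - f t) \<le> e"
  shows "cmod (cell_average n f t - f t) \<le> e"
proof -
  obtain k where k: "k \<le> n" "\<And>j. t \<in> cell n j \<longleftrightarrow> j = k" using ex1_cell[OF t] by blast
  let ?N = "real (Suc n)"
  have space: "cell n k \<inter> {0<..<1} = cell n k" by (auto simp: cell_def)
  have const: "(\<integral>s. indicator (cell n k) s *\<^sub>R c \<partial>unit_interval) = (1 / ?N) *\<^sub>R c"
    for c :: "'a::{banach, second_countable_topology}"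
    using measure_cell_eq[OF k(1)] cell_in_sets[of n k]
      finite_measure.emeasure_finite[OF finite_measure_unit_interval]
    by (subst integral_scaleR_left)
      (auto simp: space less_top finite_measure.emeasure_finite intro!: integrable_real_indicator)
  have diff: "integrable unit_interval (\<lambda>s. f s - f t)"
    by (rule Bochner_Integration.integrable_diff[OF f integrable_unit_interval_const])
  have "cell_average n f t = of_nat (Suc n) * cell_integral n k f"
    unfolding cell_average_def by (rule sum_indicator_cell[OF k])
  moreover have "f t = of_nat (Suc n) * cell_integral n k (\<lambda>_. f t)"
    unfolding const by (simp add: scaleR_conv_of_real field_simps del: of_nat_Suc)
  ultimately have "cell_average n f t - f t
      = of_nat (Suc n) * (cell_integral n k f - cell_integral n k (\<lambda>_. f t))"
    by (simp only: right_diff_distrib)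
  also have "cell_integral n k f - cell_integral n k (\<lambda>_. f t) = cell_integral n k (\<lambda>s. f s - f t)"
    unfolding scaleR_diff_right
    by (rule Bochner_Integration.integral_diff[symmetric,
          OF integrable_cell[OF f] integrable_cell[OF integrable_unit_interval_const]])
  finally have "cmod (cell_average n f t - f t) = ?N * cmod (cell_integral n k (\<lambda>s. f s - f t))"
    by (simp only: norm_mult norm_of_nat)
  also have "cmod (cell_integral n k (\<lambda>s. f s - f t))
      \<le> (\<integral>s. indicator (cell n k) s *\<^sub>R e \<partial>unit_interval)"
  proof (rule order_trans[OF integral_norm_bound integral_mono])
    show "integrable unit_interval (\<lambda>s. cmod (indicator (cell n k) s *\<^sub>R (f s - f t)))"
      using integrable_cell[OF diff] by (rule integrable_norm)
    show "integrable unit_interval (\<lambda>s. indicator (cell n k) s *\<^sub>R e)"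
      by (rule integrable_cell[OF integrable_unit_interval_const])
    fix s
    have "cmod (f s - f t) \<le> e" if "s \<in> cell n k"
    proof (rule osc)
      show "s \<in> {0<..<1}" using that by (simp add: cell_def)
      have "t \<in> cell n k" by (simp add: k(2))
      with that have "s \<in> {real k / ?N .. real (Suc k) / ?N}" "t \<in> {real k / ?N .. real (Suc k) / ?N}"
        using cell_subset[of n k] by blast+
      then have "\<bar>s - t\<bar> \<le> real (Suc k) / ?N - real k / ?N"
        unfolding atLeastAtMost_iff by linarith
      then show "\<bar>s - t\<bar> \<le> 1 / ?N" by (simp flip: diff_divide_distrib)
    qed
    then show "cmod (indicator (cell n k) s *\<^sub>R (f s - f t)) \<le> indicator (cell n k) s *\<^sub>R e"
      by (simp add: indicator_def)
  qed
  also have "?N * (\<integral>s. indicator (cell n k) s *\<^sub>R e \<partial>unit_interval) = e"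
    unfolding const by simp
  finally show ?thesis by simp
qed

lemma dist_abs_L1:
  assumes "integrable unit_interval f" "integrable unit_interval g"
  shows "dist (abs_L1 f) (abs_L1 g) = (\<integral>t. cmod (f t - g t) \<partial>unit_interval)"
  using assms by (simp add: dist_norm minus_L1.abs_eq norm_L1.abs_eq)

lemma synthesis_analysis_abs_L1:
  assumes f: "integrable unit_interval f"
  shows "integrable unit_interval (cell_average n f)"
    and "synthesis (analysis n (abs_L1 f)) = abs_L1 (cell_average n f)"
proof -
  have eq: "(\<lambda>t. \<Sum>i. level n (\<lambda>k. cell_integral n k f) i * bump i t) = cell_average n f"
    by (simp only: synthesis_level)
  show "integrable unit_interval (cell_average n f)"
    using integrable_synthesis[OF summable_norm_level] unfolding eq[symmetric] .
  show "synthesis (analysis n (abs_L1 f)) = abs_L1 (cell_average n f)"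
    using f by (simp add: analysis.abs_eq synthesis.abs_eq eq_onp_def summable_norm_level synthesis_level)
qed

lemma averages_of_continuous_tendsto:
  assumes cont: "continuous_on UNIV f" and f: "integrable unit_interval f"
  shows "(\<lambda>n. synthesis (analysis n (abs_L1 f))) \<longlonglongrightarrow> abs_L1 f"
proof (rule metric_LIMSEQ_I)
  fix e :: real assume "e > 0"
  have "uniformly_continuous_on {0..1} f"
    by (rule compact_uniformly_continuous) (use cont continuous_on_subset in auto)
  then obtain d where "d > 0"
    and d: "\<And>s t. s \<in> {0..1} \<Longrightarrow> t \<in> {0..1} \<Longrightarrow> dist s t < d \<Longrightarrow> dist (f s) (f t) < e / 2"
    using \<open>e > 0\<close> unfolding uniformly_continuous_on_def by (metis half_gt_zero)
  obtain N where N: "1 / real (Suc N) < d"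
    using \<open>d > 0\<close> nat_approx_posE by (metis of_nat_Suc)
  have "dist (synthesis (analysis n (abs_L1 f))) (abs_L1 f) < e" if "n \<ge> N" for n
  proof -
    have nd: "1 / real (Suc n) < d"
      using N that by (smt (verit) frac_le of_nat_0_less_iff of_nat_mono zero_less_Suc Suc_le_mono)
    have "dist (synthesis (analysis n (abs_L1 f))) (abs_L1 f)
        = (\<integral>t. cmod (cell_average n f t - f t) \<partial>unit_interval)"
      using synthesis_analysis_abs_L1[OF f] f by (simp add: dist_abs_L1)
    also have "\<dots> \<le> (\<integral>t. e / 2 \<partial>unit_interval)"
    proof (rule integral_mono)
      show "integrable unit_interval (\<lambda>t. cmod (cell_average n f t - f t))"
        using f synthesis_analysis_abs_L1(1)[OF f] by auto
      fix t assume "t \<in> space unit_interval"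
      then have t: "t \<in> {0<..<1}" by simp
      then show "cmod (cell_average n f t - f t) \<le> e / 2"
      proof (rule cell_average_dist_le[OF f])
        fix s :: real assume "s \<in> {0<..<1}" "\<bar>s - t\<bar> \<le> 1 / real (Suc n)"
        with d[of s t] t nd show "cmod (f s - f t) \<le> e / 2" by (simp add: dist_norm)
      qed
    qed (rule integrable_unit_interval_const)
    also have "\<dots> = e / 2" by (simp add: measure_unit_interval)
    finally show ?thesis using \<open>e > 0\<close> by simp
  qed
  then show "\<exists>N. \<forall>n\<ge>N. dist (synthesis (analysis n (abs_L1 f))) (abs_L1 f) < e" by blast
qed

text \<open>
  Since contractions are equicontinuous, the points at which they converge to the identity form a
  closed set; the density arguments below rest on this.
\<close>

lemma contractions_tendsto_of_limit:
  fixes T :: "nat \<Rightarrow> 'a::complex_normed_vector \<Rightarrow> 'a"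
  assumes T: "\<And>n. clinear_contraction (T n)"
    and y: "\<And>m. (\<lambda>n. T n (y m)) \<longlonglongrightarrow> y m" and lim: "(\<lambda>m. dist (y m) x) \<longlonglongrightarrow> 0"
  shows "(\<lambda>n. T n x) \<longlonglongrightarrow> x"
proof (rule metric_LIMSEQ_I)
  fix e :: real assume "e > 0"
  then have "\<forall>\<^sub>F m in sequentially. dist (y m) x < e / 3"
    by (intro order_tendstoD(2)[OF lim]) simp
  then obtain m where m: "dist (y m) x < e / 3" by (meson eventually_happens sequentially_bot)
  obtain N where N: "\<And>n. n \<ge> N \<Longrightarrow> dist (T n (y m)) (y m) < e / 3"
    using metric_LIMSEQ_D[OF y, of "e/3" m] \<open>e > 0\<close> by auto
  have "dist (T n x) x < e" if "n \<ge> N" for n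
    using N[OF that] m clinear_contraction_dist[OF T, of n x "y m"]
      dist_triangle[of "T n x" x "T n (y m)"] dist_triangle[of "T n (y m)" x "y m"]
    by (simp add: dist_commute)
  then show "\<exists>N. \<forall>n\<ge>N. dist (T n x) x < e" by blast
qed

lemma clinear_contraction_synthesis_analysis:
  "clinear_contraction (\<lambda>x. synthesis (analysis n x))"
  using clinear_contraction_synthesis clinear_contraction_analysis[of n]
  unfolding clinear_contraction_def by (metis order_trans)

lemma averages_tendsto_of_dominated:
  assumes s: "\<And>m. integrable unit_interval (s m)" and f: "integrable unit_interval f"
    and w: "integrable unit_interval w"
    and bound: "\<And>m t. cmod (s m t) \<le> w t"
    and lim: "AE t in unit_interval. (\<lambda>m. s m t) \<longlonglongrightarrow> f t"
    and conv: "\<And>m. (\<lambda>n. synthesis (analysis n (abs_L1 (s m)))) \<longlonglongrightarrow> abs_L1 (s m)"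
  shows "(\<lambda>n. synthesis (analysis n (abs_L1 f))) \<longlonglongrightarrow> abs_L1 f"
proof (rule contractions_tendsto_of_limit[OF clinear_contraction_synthesis_analysis conv])
  have "(\<lambda>m. \<integral>t. cmod (s m t - f t) \<partial>unit_interval) \<longlonglongrightarrow> (\<integral>t. 0 \<partial>unit_interval)"
  proof (rule integral_dominated_convergence[where w = "\<lambda>t. w t + cmod (f t)"])
    show "AE t in unit_interval. (\<lambda>m. cmod (s m t - f t)) \<longlonglongrightarrow> 0"
      using lim by eventually_elim (simp add: LIM_zero tendsto_norm_zero)
    show "AE t in unit_interval. norm (cmod (s m t - f t)) \<le> w t + cmod (f t)" for m
      using bound[of m] by (auto intro!: AE_I2 order_trans[OF norm_triangle_ineq4])
  qed (use s f w in auto)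
  then show "(\<lambda>m. dist (abs_L1 (s m)) (abs_L1 f)) \<longlonglongrightarrow> 0"
    by (simp add: dist_abs_L1 s f)
qed

text \<open>
  A measurable function is almost everywhere a limit of continuous functions. Projecting these onto
  the disc that contains the values of \<open>f\<close> makes them dominated and does not disturb the limit.
\<close>

lemma averages_of_bounded_tendsto:
  assumes f: "integrable unit_interval f" and B: "\<And>t. cmod (f t) \<le> B"
  shows "(\<lambda>n. synthesis (analysis n (abs_L1 f))) \<longlonglongrightarrow> abs_L1 f"
proof -
  have "B \<ge> 0" using B[of 0] norm_ge_zero order_trans by blast
  have "f measurable_on {0<..<1}"
    using borel_measurable_integrable[OF f] by (simp add: measurable_on_iff_borel_measurable)
  then obtain N g where N: "negligible N" and g: "\<And>m. continuous_on UNIV (g m)"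
    and lim: "\<And>t. t \<notin> N \<Longrightarrow> (\<lambda>m. g m t) \<longlonglongrightarrow> (if t \<in> {0<..<1} then f t else 0)"
    unfolding measurable_on_def by blast
  define clip where "clip = closest_point (cball (0::complex) B)"
  have cont_clip: "continuous_on UNIV clip"
    unfolding clip_def using \<open>B \<ge> 0\<close> by (intro continuous_on_closest_point) auto
  have norm_clip: "cmod (clip z) \<le> B" for z
    using closest_point_in_set[of "cball (0::complex) B" z] \<open>B \<ge> 0\<close> by (simp add: clip_def)
  have clip_f: "clip (f t) = f t" for t
    unfolding clip_def using B by (intro closest_point_self) simp
  define s where "s = (\<lambda>m t. clip (g m t))"
  have cont: "continuous_on UNIV (s m)" for m
    unfolding s_def using continuous_on_compose2[OF cont_clip g] by simp
  have int: "integrable unit_interval (s m)" for m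
  proof (rule finite_measure.integrable_const_bound[OF finite_measure_unit_interval])
    show "AE t in unit_interval. cmod (s m t) \<le> B" by (simp add: s_def norm_clip)
    show "s m \<in> borel_measurable unit_interval"
      by (intro continuous_imp_measurable_on_sets_lebesgue continuous_on_subset[OF cont]) auto
  qed
  show ?thesis
  proof (rule averages_tendsto_of_dominated[OF int f integrable_unit_interval_const[of B]])
    have "AE t in lebesgue. t \<notin> N"
      using N by (intro AE_not_in) (simp add: negligible_iff_null_sets)
    then have "AE t in lebesgue. t \<in> {0<..<1} \<longrightarrow> (\<lambda>m. s m t) \<longlonglongrightarrow> f t"
    proof eventually_elim
      fix t assume "t \<notin> N"
      have "(\<lambda>m. clip (g m t)) \<longlonglongrightarrow> clip (f t)" if "t \<in> {0<..<1}"
        using lim[OF \<open>t \<notin> N\<close>] that cont_clip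
        by (intro continuous_on_tendsto_compose[OF cont_clip]) auto
      then show "t \<in> {0<..<1} \<longrightarrow> (\<lambda>m. s m t) \<longlonglongrightarrow> f t" by (simp add: s_def clip_f)
    qed
    then show "AE t in unit_interval. (\<lambda>m. s m t) \<longlonglongrightarrow> f t"
      by (subst AE_restrict_space_iff) auto
    show "(\<lambda>n. synthesis (analysis n (abs_L1 (s m)))) \<longlonglongrightarrow> abs_L1 (s m)" for m
      by (rule averages_of_continuous_tendsto[OF cont int])
  qed (simp add: s_def norm_clip)
qed

text \<open>
  Truncation at height \<open>m\<close> reduces the general case to bounded functions.
\<close>

lemma synthesis_analysis_tendsto: "(\<lambda>n. synthesis (analysis n x)) \<longlonglongrightarrow> x"
proof (induction x rule: L1.abs_induct)
  fix f :: "real \<Rightarrow> complex"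
  assume "integrable unit_interval f \<and> integrable unit_interval f \<and>
      (AE t in unit_interval. f t = f t)"
  then have f: "integrable unit_interval f" by simp
  define s where "s = (\<lambda>m t. if cmod (f t) \<le> real m then f t else 0)"
  have int: "integrable unit_interval (s m)" for m
  proof (rule Bochner_Integration.integrable_bound[OF f])
    have [measurable]: "f \<in> borel_measurable unit_interval" using f by simp
    show "s m \<in> borel_measurable unit_interval" unfolding s_def by measurable
  qed (simp add: s_def)
  show "(\<lambda>n. synthesis (analysis n (abs_L1 f))) \<longlonglongrightarrow> abs_L1 f"
  proof (rule averages_tendsto_of_dominated[OF int f integrable_norm[OF f]])
    show "cmod (s m t) \<le> cmod (f t)" for m t by (simp add: s_def)
    have "(\<lambda>m. s m t) \<longlonglongrightarrow> f t" for t
    proof (rule tendsto_eventually)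
      obtain k :: nat where "cmod (f t) \<le> real k" using real_arch_simple by blast
      then show "\<forall>\<^sub>F m in sequentially. s m t = f t"
        unfolding eventually_sequentially s_def
        by (intro exI[of _ k]) auto
    qed
    then show "AE t in unit_interval. (\<lambda>m. s m t) \<longlonglongrightarrow> f t" by simp
    show "(\<lambda>n. synthesis (analysis n (abs_L1 (s m)))) \<longlonglongrightarrow> abs_L1 (s m)" for m
      by (rule averages_of_bounded_tendsto[OF int, of _ "real m"]) (simp add: s_def)
  qed
qed

theorem mainTheorem2:
  fixes H :: algebra_kind
  assumes "satisfies_cluster_value_theorem TYPE(ell1) H"
  shows "satisfies_cluster_value_theorem TYPE(L1) H"
  using clinear_contraction_synthesis clinear_contraction_analysis synthesis_analysis_tendsto assms
  by (rule cluster_value_theorem_transfer)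

end
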